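(* Let $K\subset\mathbb{R}^3$ be a $C^{1,1}$ link of thickness $\tau>0$. For any $\delta<\tau/4$, set $\theta:=\pi/2-2\arcsin(2\delta/\tau)$. Then any rectifiable link $K'\subset\mathbb{R}^3$ which is $(\delta,\theta)$-close to $K$ is ambient isotopic to $K$; moreover the ambient isotopy can be chosen to move no point a distance more than $\delta$.
   Context: The thickness $\tau(K)$ of a space curve $K$ is twice the infimal radius of circles through any three distinct points of $K$. (A link is $C^{1,1}$, i.e. $C^1$ with Lipschitz unit tangent vector, if and only if it has positive thickness; $\tau(K)$ is then the supremal diameter of an embedded normal tube around $K$.) A rectifiable curve (a curve of finite length) has a well-defined tangent vector almost everywhere. Two rectifiable links $K$ and $K'$ (with the same number of components) are $(\delta,\theta)$-close if there exists a homeomorphism between them such that corresponding points are within distance $\delta$ of each other, and corresponding tangent vectors are within angle $\theta$ of each other almost everywhere. *)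

theory Defs
  imports "HOL-Analysis.Analysis"
begin

text \<open>
  A simple closed curve is given by a map that has period 1 on the whole line and is a
  \<^const>\<open>simple_path\<close> on the unit interval; periodicity allows two-sided limits at the base point.
\<close>

definition simple_loop :: "(real \<Rightarrow> real ^ 3) \<Rightarrow> bool" where
  "simple_loop \<gamma> \<longleftrightarrow> simple_path \<gamma> \<and> (\<forall>t. \<gamma> (t + 1) = \<gamma> t)"

definition link_param :: "nat \<Rightarrow> (nat \<Rightarrow> real \<Rightarrow> real ^ 3) \<Rightarrow> (real ^ 3) set \<Rightarrow> bool" where
  "link_param n \<gamma> K \<longleftrightarrow>
     n \<ge> 1 \<and> (\<forall>i<n. simple_loop (\<gamma> i)) \<and>
     disjoint_family_on (\<lambda>i. path_image (\<gamma> i)) {..<n} \<and>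
     K = (\<Union>i<n. path_image (\<gamma> i))"

definition C11_link :: "(real ^ 3) set \<Rightarrow> bool" where
  "C11_link K \<longleftrightarrow>
     (\<exists>n \<gamma>. link_param n \<gamma> K \<and>
       (\<forall>i<n. \<exists>\<gamma>' L. (\<forall>t. (\<gamma> i has_vector_derivative \<gamma>' t) (at t)) \<and>
          continuous_on UNIV \<gamma>' \<and> (\<forall>t. \<gamma>' t \<noteq> 0) \<and>
          L-lipschitz_on UNIV (\<lambda>t. sgn (\<gamma>' t))))"

definition inscribed_lengths :: "(real \<Rightarrow> real ^ 3) \<Rightarrow> real \<Rightarrow> real \<Rightarrow> real set" where
  "inscribed_lengths \<gamma> a b =
     {(\<Sum>k<m. dist (\<gamma> (s k)) (\<gamma> (s (Suc k)))) | (m::nat) (s :: nat \<Rightarrow> real).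
        mono_on {..m} s \<and> s ` {..m} \<subseteq> {a..b}}"

definition rectifiable :: "(real \<Rightarrow> real ^ 3) \<Rightarrow> bool" where
  "rectifiable \<gamma> \<longleftrightarrow> bdd_above (inscribed_lengths \<gamma> 0 1)"

definition arc_length :: "(real \<Rightarrow> real ^ 3) \<Rightarrow> real \<Rightarrow> real \<Rightarrow> real" where
  "arc_length \<gamma> a b = Sup (inscribed_lengths \<gamma> a b)"

definition rectifiable_link :: "(real ^ 3) set \<Rightarrow> bool" where
  "rectifiable_link K \<longleftrightarrow> (\<exists>n \<gamma>. link_param n \<gamma> K \<and> (\<forall>i<n. rectifiable (\<gamma> i)))"

definition is_circle :: "(real ^ 3) set \<Rightarrow> real \<Rightarrow> bool" where
  "is_circle C r \<longleftrightarrow>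
     r > 0 \<and> (\<exists>c n. n \<noteq> 0 \<and> C = {x. dist c x = r \<and> n \<bullet> (x - c) = 0})"

text \<open>
  Collinear triples lie on no circle and so do not contribute to the infimum
  (their circumradius is infinite).
\<close>

definition thickness :: "(real ^ 3) set \<Rightarrow> real" where
  "thickness K =
     2 * Inf {r. \<exists>x\<in>K. \<exists>y\<in>K. \<exists>z\<in>K. x \<noteq> y \<and> y \<noteq> z \<and> x \<noteq> z \<and>
                 (\<exists>C. is_circle C r \<and> {x, y, z} \<subseteq> C)}"

text \<open>
  The unit tangent vector as the limit of the directions of oriented secants. It does not depend
  on the parametrization beyond its orientation, and on a simple rectifiable curve it agrees
  almost everywhere with the derivative with respect to arc length.
\<close>

definition has_unit_tangent :: "(real \<Rightarrow> real ^ 3) \<Rightarrow> real ^ 3 \<Rightarrow> real \<Rightarrow> bool" where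
  "has_unit_tangent \<gamma> u t \<longleftrightarrow> ((\<lambda>s. sgn (s - t) *\<^sub>R sgn (\<gamma> s - \<gamma> t)) \<longlongrightarrow> u) (at t)"

definition vec_angle :: "real ^ 3 \<Rightarrow> real ^ 3 \<Rightarrow> real" where
  "vec_angle u v = arccos (u \<bullet> v / (norm u * norm v))"

text \<open>
  A set of parameters in the unit interval is null for a rectifiable curve if the corresponding
  part of the curve has zero length.
\<close>

definition length_null :: "(real \<Rightarrow> real ^ 3) \<Rightarrow> real set \<Rightarrow> bool" where
  "length_null \<gamma> E \<longleftrightarrow> negligible (arc_length \<gamma> 0 ` E)"

text \<open>
  A parametrization of \<open>K\<close> is transported to one of \<open>K'\<close> by the homeomorphism \<open>h\<close>; this
  orients corresponding components compatibly, and reversing the orientation of a component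
  reverses both tangent vectors, so that the choice of parametrization is immaterial.
  Since \<open>h\<close> need not preserve sets of zero length, ``almost everywhere'' is understood with
  respect to arc length on both curves.
\<close>

definition links_close :: "real \<Rightarrow> real \<Rightarrow> (real ^ 3) set \<Rightarrow> (real ^ 3) set \<Rightarrow> bool" where
  "links_close \<delta> \<theta> K K' \<longleftrightarrow>
     (\<exists>h g. homeomorphism K K' h g \<and> (\<forall>p\<in>K. dist p (h p) \<le> \<delta>) \<and>
       (\<exists>n \<gamma>. link_param n \<gamma> K \<and>
         (\<forall>i<n. \<exists>E. length_null (\<gamma> i) E \<and> length_null (h \<circ> \<gamma> i) E \<and>
            (\<forall>t\<in>{0..1} - E. \<exists>u v. has_unit_tangent (\<gamma> i) u t \<and>
               has_unit_tangent (h \<circ> \<gamma> i) v t \<and> vec_angle u v \<le> \<theta>))))"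

definition ambient_isotopy :: "(real \<Rightarrow> real ^ 3 \<Rightarrow> real ^ 3) \<Rightarrow> bool" where
  "ambient_isotopy H \<longleftrightarrow>
     continuous_on ({0..1} \<times> UNIV) (\<lambda>(t, x). H t x) \<and>
     (\<forall>t\<in>{0..1}. \<exists>G. homeomorphism UNIV UNIV (H t) G) \<and>
     (\<forall>x. H 0 x = x)"

end

theory Submission
  imports Defs
begin

text \<open>
Write \<open>\<rho> = \<tau> / 2\<close>. By the definition of thickness, a circle through \<open>p\<close>, a nearby point of \<open>K\<close> and a third
point \<open>q\<close> of \<open>K\<close> has radius at least \<open>\<rho>\<close>; in the limit, so has the circle through \<open>q\<close> that is tangent to
\<open>K\<close> at \<open>p\<close> (\<open>tangent_circle_inequality\<close>). This inequality has two consequences. The nearest-point map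
\<open>foot\<close> onto \<open>K\<close> is well defined and continuous on the tube of radius \<open>\<rho>\<close>, where its fibres are the normal
disks (\<open>foot_eqI\<close>, \<open>continuous_on_foot\<close>). And the tangent lines at the ends of a chord of length \<open>l\<close>
make an angle of at most \<open>2 arcsin (l / (2 \<rho>))\<close> (\<open>T_inner_ge\<close>).

Let \<open>\<gamma>\<close> parametrize a component of \<open>K\<close>, and let \<open>\<sigma> = h \<circ> \<gamma>\<close>. The foot of \<open>\<sigma> t\<close> has distance less than
\<open>2 \<delta>\<close> from \<open>\<gamma> t\<close> (\<open>foot_drift\<close>), so the tangents of \<open>K\<close> at these points differ by less than
\<open>2 arcsin (\<delta> / \<rho>) = \<pi>/2 - \<theta>\<close>; which of the two directions of the tangent line is meant is decided by following
the foot along the segment from \<open>\<gamma> t\<close> to \<open>\<sigma> t\<close> (\<open>tangent_sign_persists\<close>). Together with the bound \<open>\<theta>\<close> on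
the angle between \<open>\<gamma>\<close> and \<open>\<sigma>\<close>, the tangent of \<open>\<sigma>\<close> almost everywhere makes an angle below \<open>\<pi>/2\<close> with the
tangent of \<open>K\<close> at the foot (\<open>transversality\<close>).

Write the foot of \<open>\<sigma> t\<close> as \<open>\<kappa> (f t)\<close> with a regular parametrization \<open>\<kappa>\<close> and a continuous real function
\<open>f\<close>. Locally \<open>f\<close> is Lipschitz with respect to \<open>\<sigma>\<close> (\<open>foot_chart_estimate\<close>), so it maps the exceptional set of
zero length to a null set, and it increases at all other parameters. Hence it is strictly increasing
(\<open>strict_mono_off_length_null\<close>). A homotopy from \<open>\<gamma>\<close> to \<open>foot \<circ> \<sigma>\<close> shows that \<open>f\<close> grows by exactly one
period (\<open>homotopy_lift\<close>). So \<open>K'\<close> meets every normal disk exactly once, at distance at most \<open>\<delta>\<close> from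
its center, and can be pushed to the center inside each disk. As \<open>2 \<delta> < \<rho>\<close>, there is enough room for a
push that is injective and moves no point by more than \<open>\<delta>\<close> (\<open>isotopy_onto_core\<close>).
\<close>

section \<open>Thickness and tangent circles\<close>

lemma thickness_le_circle_diameter:
  assumes "is_circle C r" "{x, y, z} \<subseteq> C" "{x, y, z} \<subseteq> K" "x \<noteq> y" "y \<noteq> z" "x \<noteq> z"
  shows "thickness K \<le> 2 * r"
proof -
  let ?A = "{r. \<exists>x\<in>K. \<exists>y\<in>K. \<exists>z\<in>K. x \<noteq> y \<and> y \<noteq> z \<and> x \<noteq> z \<and>
                 (\<exists>C. is_circle C r \<and> {x, y, z} \<subseteq> C)}"
  have "bdd_below ?A"
    by (rule bdd_belowI[of _ 0]) (auto simp: is_circle_def)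
  moreover have "r \<in> ?A" using assms by blast
  ultimately have "Inf ?A \<le> r" by (rule cInf_lower[rotated])
  then show ?thesis by (simp add: thickness_def)
qed

text \<open>
If \<open>D = |a|\<^sup>2 |b|\<^sup>2 - (a \<bullet> b)\<^sup>2\<close> is positive, the circle through \<open>p\<close>, \<open>p + a\<close> and \<open>p + b\<close> has radius
\<open>|a| |b| |a - b| / (2 \<surd>D)\<close>, and this is at least half the thickness. Cleared of denominators, the
bound also covers collinear triples and coinciding points, and its two sides are polynomials,
so that limits are easy to take.
\<close>

lemma circumradius_inequality:
  fixes K :: "(real^3) set"
  assumes "thickness K > 0" "p \<in> K" "p + a \<in> K" "p + b \<in> K"
  shows "(thickness K)\<^sup>2 * ((a \<bullet> a) * (b \<bullet> b) - (a \<bullet> b)\<^sup>2)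
    \<le> (a \<bullet> a) * (b \<bullet> b) * ((a - b) \<bullet> (a - b))"
proof -
  let ?A = "a \<bullet> a" and ?B = "b \<bullet> b" and ?G = "a \<bullet> b"
  define D where "D = ?A * ?B - ?G\<^sup>2"
  have rhs: "0 \<le> ?A * ?B * ((a - b) \<bullet> (a - b))" by simp
  have D0: "D \<ge> 0" using Cauchy_Schwarz_ineq[of a b] by (simp add: D_def)
  show ?thesis
  proof (cases "D = 0")
    case True
    then show ?thesis using rhs by (simp add: D_def)
  next
    case False
    then have Dpos: "D > 0" using D0 by simp
    have ne: "a \<noteq> 0" "b \<noteq> 0" "a \<noteq> b"
      using Dpos by (auto simp: D_def power2_eq_square)
    \<comment> \<open>The circumcenter \<open>p + c\<close> comes from solving \<open>c \<bullet> a = |a|\<^sup>2 / 2\<close> and \<open>c \<bullet> b = |b|\<^sup>2 / 2\<close> in the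
       plane of the triangle.\<close>
    define l m where "l = ?B * (?A - ?G) / (2 * D)" and "m = ?A * (?B - ?G) / (2 * D)"
    define c where "c = l *\<^sub>R a + m *\<^sub>R b"
    have ca: "c \<bullet> a = ?A / 2"
    proof -
      have "c \<bullet> a = l * ?A + m * ?G" by (simp add: c_def inner_add_left inner_commute[of b a])
      also have "\<dots> = (?B * (?A - ?G) * ?A + ?A * (?B - ?G) * ?G) / (2 * D)"
        by (simp add: l_def m_def add_divide_distrib)
      also have "?B * (?A - ?G) * ?A + ?A * (?B - ?G) * ?G = ?A * D"
        by (simp add: D_def algebra_simps power2_eq_square)
      finally show ?thesis using Dpos by simp
    qed
    have cb: "c \<bullet> b = ?B / 2"
    proof -
      have "c \<bullet> b = l * ?G + m * ?B" by (simp add: c_def inner_add_left)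
      also have "\<dots> = (?B * (?A - ?G) * ?G + ?A * (?B - ?G) * ?B) / (2 * D)"
        by (simp add: l_def m_def add_divide_distrib)
      also have "?B * (?A - ?G) * ?G + ?A * (?B - ?G) * ?B = ?B * D"
        by (simp add: D_def algebra_simps power2_eq_square)
      finally show ?thesis using Dpos by simp
    qed
    have cc: "4 * D * (c \<bullet> c) = ?A * ?B * ((a - b) \<bullet> (a - b))"
    proof -
      have "c \<bullet> c = l * (c \<bullet> a) + m * (c \<bullet> b)"
        by (subst (2) c_def) (simp add: inner_add_right)
      also have "\<dots> = (?B * (?A - ?G) * ?A + ?A * (?B - ?G) * ?B) / (4 * D)"
        by (simp add: ca cb l_def m_def add_divide_distrib)
      finally have "4 * D * (c \<bullet> c) = ?B * (?A - ?G) * ?A + ?A * (?B - ?G) * ?B"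
        using Dpos by simp
      then show ?thesis
        by (simp add: algebra_simps inner_diff inner_commute[of b a])
    qed
    have cne: "c \<noteq> 0" using ca ne by auto
    define n where "n = cross3 a b"
    have "(norm n)\<^sup>2 = D"
      using norm_cross_dot[of a b]
      by (simp add: n_def D_def power_mult_distrib power2_norm_eq_inner)
    then have nne: "n \<noteq> 0" using Dpos by auto
    have na: "n \<bullet> a = 0" "n \<bullet> b = 0" by (simp_all add: n_def dot_cross_self)
    then have nc: "n \<bullet> c = 0" by (simp add: c_def inner_add_right)
    have dist_eq: "dist (p + c) (p + e) = norm c" if "c \<bullet> e = (e \<bullet> e) / 2" for e
    proof -
      have "(norm (c - e))\<^sup>2 = (norm c)\<^sup>2"
        unfolding power2_norm_eq_inner using that by (simp add: inner_diff inner_commute)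
      then show ?thesis by (simp add: dist_norm)
    qed
    define C where "C = {x. dist (p + c) x = norm c \<and> n \<bullet> (x - (p + c)) = 0}"
    have "is_circle C (norm c)"
      unfolding is_circle_def C_def using cne nne by auto
    moreover have "{p, p + a, p + b} \<subseteq> C"
      using dist_eq[OF ca] dist_eq[OF cb] na nc
      by (auto simp: C_def inner_diff_right inner_add_right dist_norm)
    ultimately have "thickness K \<le> 2 * norm c"
      by (rule thickness_le_circle_diameter) (use assms ne in auto)
    then have "(thickness K)\<^sup>2 \<le> (2 * norm c)\<^sup>2"
      using assms(1) by (intro power_mono) auto
    then have "(thickness K)\<^sup>2 \<le> 4 * (c \<bullet> c)"
      by (simp add: power_mult_distrib power2_norm_eq_inner)
    then have "(thickness K)\<^sup>2 * D \<le> 4 * (c \<bullet> c) * D"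
      using Dpos by (intro mult_right_mono) auto
    also have "4 * (c \<bullet> c) * D = ?A * ?B * ((a - b) \<bullet> (a - b))" using cc by (metis mult.assoc mult.commute)
    finally show ?thesis by (simp add: D_def)
  qed
qed

lemma difference_quotient_tendsto:
  fixes f :: "real \<Rightarrow> 'a::real_normed_vector"
  assumes "(f has_vector_derivative d) (at t)"
  shows "((\<lambda>s. (f s - f t) /\<^sub>R (s - t)) \<longlongrightarrow> d) (at t)"
proof -
  have "((\<lambda>y. ((f y - f t) - (y - t) *\<^sub>R d) /\<^sub>R norm (y - t)) \<longlongrightarrow> 0) (at t)"
    using assms unfolding has_vector_derivative_def has_derivative_at_within by blast
  then have "((\<lambda>y. norm (((f y - f t) - (y - t) *\<^sub>R d) /\<^sub>R norm (y - t))) \<longlongrightarrow> 0) (at t)"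
    by (rule tendsto_norm_zero)
  then have "((\<lambda>y. norm ((f y - f t) /\<^sub>R (y - t) - d)) \<longlongrightarrow> 0) (at t)"
  proof (rule Lim_transform_eventually)
    have "norm (((f y - f t) - (y - t) *\<^sub>R d) /\<^sub>R norm (y - t)) = norm ((f y - f t) /\<^sub>R (y - t) - d)"
      if "y \<noteq> t" for y
    proof -
      have "(f y - f t) /\<^sub>R (y - t) - d = ((f y - f t) - (y - t) *\<^sub>R d) /\<^sub>R (y - t)"
        using that by (simp add: scaleR_right_diff_distrib)
      then show ?thesis by simp
    qed
    then show "\<forall>\<^sub>F y in at t. norm (((f y - f t) - (y - t) *\<^sub>R d) /\<^sub>R norm (y - t))
        = norm ((f y - f t) /\<^sub>R (y - t) - d)"
      by (auto simp: eventually_at intro!: exI[of _ 1])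
  qed
  then show ?thesis using Lim_null tendsto_norm_zero_iff by blast
qed

lemma has_unit_tangent_derivative:
  assumes "(\<kappa> has_vector_derivative d) (at t)" "d \<noteq> 0"
  shows "has_unit_tangent \<kappa> (sgn d) t"
  unfolding has_unit_tangent_def
proof (rule Lim_transform_eventually)
  show "((\<lambda>s. sgn ((\<kappa> s - \<kappa> t) /\<^sub>R (s - t))) \<longlongrightarrow> sgn d) (at t)"
    by (rule tendsto_sgn[OF difference_quotient_tendsto[OF assms(1)] assms(2)])
  show "\<forall>\<^sub>F s in at t. sgn ((\<kappa> s - \<kappa> t) /\<^sub>R (s - t)) = sgn (s - t) *\<^sub>R sgn (\<kappa> s - \<kappa> t)"
    by (simp add: sgn_scaleR sgn_inverse sgn_if)
qed

text \<open>
As a point of \<open>K\<close> tends to \<open>\<kappa> t\<close> along the curve, the circles through it, \<open>\<kappa> t\<close> and \<open>q\<close> tend to the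
circle through \<open>q\<close> that is tangent to the curve at \<open>\<kappa> t\<close>; hence the tangent circle has diameter at
least the thickness as well. Its diameter is \<open>|q - \<kappa> t|\<^sup>2\<close> divided by the distance of \<open>q\<close> from the
tangent line.
\<close>

lemma tangent_circle_inequality:
  fixes K :: "(real^3) set" and \<kappa> :: "real \<Rightarrow> real^3"
  assumes pos: "thickness K > 0" and K: "range \<kappa> \<subseteq> K" "q \<in> K"
    and der: "(\<kappa> has_vector_derivative d) (at t)" and "d \<noteq> 0"
  shows "(thickness K)\<^sup>2 * ((norm (q - \<kappa> t))\<^sup>2 - ((q - \<kappa> t) \<bullet> sgn d)\<^sup>2) \<le> (norm (q - \<kappa> t)) ^ 4"
proof -
  define b where "b = q - \<kappa> t"
  define a where "a s = (\<kappa> s - \<kappa> t) /\<^sub>R (s - t)" for s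
  let ?\<tau> = "thickness K"
  have lim: "(a \<longlongrightarrow> d) (at t)"
    using difference_quotient_tendsto[OF der] by (simp add: a_def[abs_def])
  \<comment> \<open>The quotient \<open>a s\<close> in place of the chord: the inequality is homogeneous in the chord, and the
     quotient has a nonzero limit.\<close>
  have ev: "?\<tau>\<^sup>2 * ((a s \<bullet> a s) * (b \<bullet> b) - (a s \<bullet> b)\<^sup>2)
     \<le> (a s \<bullet> a s) * (b \<bullet> b) * (((s - t) *\<^sub>R a s - b) \<bullet> ((s - t) *\<^sub>R a s - b))"
    if "s \<noteq> t" for s
  proof -
    define h where "h = s - t"
    have h: "h \<noteq> 0" using that by (simp add: h_def)
    have ha: "h *\<^sub>R a s = \<kappa> s - \<kappa> t" using h by (simp add: a_def h_def)
    have "?\<tau>\<^sup>2 * (((h *\<^sub>R a s) \<bullet> (h *\<^sub>R a s)) * (b \<bullet> b) - ((h *\<^sub>R a s) \<bullet> b)\<^sup>2)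
      \<le> ((h *\<^sub>R a s) \<bullet> (h *\<^sub>R a s)) * (b \<bullet> b) * ((h *\<^sub>R a s - b) \<bullet> (h *\<^sub>R a s - b))"
      by (rule circumradius_inequality[OF pos, of "\<kappa> t"]) (use K ha in \<open>auto simp: b_def\<close>)
    then have "h\<^sup>2 * (?\<tau>\<^sup>2 * ((a s \<bullet> a s) * (b \<bullet> b) - (a s \<bullet> b)\<^sup>2))
     \<le> h\<^sup>2 * ((a s \<bullet> a s) * (b \<bullet> b) * ((h *\<^sub>R a s - b) \<bullet> (h *\<^sub>R a s - b)))"
      by (simp add: power_mult_distrib power2_eq_square right_diff_distrib mult.assoc mult.left_commute)
    then show ?thesis using h by (simp add: h_def)
  qed
  have "?\<tau>\<^sup>2 * ((d \<bullet> d) * (b \<bullet> b) - (d \<bullet> b)\<^sup>2)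
     \<le> (d \<bullet> d) * (b \<bullet> b) * (((t - t) *\<^sub>R d - b) \<bullet> ((t - t) *\<^sub>R d - b))"
  proof (rule tendsto_le[OF _ _ _ ])
    show "((\<lambda>s. (a s \<bullet> a s) * (b \<bullet> b) * (((s - t) *\<^sub>R a s - b) \<bullet> ((s - t) *\<^sub>R a s - b)))
       \<longlongrightarrow> (d \<bullet> d) * (b \<bullet> b) * (((t - t) *\<^sub>R d - b) \<bullet> ((t - t) *\<^sub>R d - b))) (at t)"
      by (intro tendsto_intros lim)
    show "((\<lambda>s. ?\<tau>\<^sup>2 * ((a s \<bullet> a s) * (b \<bullet> b) - (a s \<bullet> b)\<^sup>2))
       \<longlongrightarrow> ?\<tau>\<^sup>2 * ((d \<bullet> d) * (b \<bullet> b) - (d \<bullet> b)\<^sup>2)) (at t)"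
      by (intro tendsto_intros lim)
    show "\<forall>\<^sub>F s in at t. ?\<tau>\<^sup>2 * ((a s \<bullet> a s) * (b \<bullet> b) - (a s \<bullet> b)\<^sup>2)
     \<le> (a s \<bullet> a s) * (b \<bullet> b) * (((s - t) *\<^sub>R a s - b) \<bullet> ((s - t) *\<^sub>R a s - b))"
      using ev by (auto simp: eventually_at intro!: exI[of _ 1])
  qed auto
  moreover have "d \<bullet> b = norm d * (b \<bullet> sgn d)"
    using \<open>d \<noteq> 0\<close> by (simp add: sgn_div_norm inner_commute)
  ultimately have "(norm d)\<^sup>2 * (?\<tau>\<^sup>2 * ((norm b)\<^sup>2 - (b \<bullet> sgn d)\<^sup>2)) \<le> (norm d)\<^sup>2 * (norm b) ^ 4"
    by (simp add: power2_norm_eq_inner[symmetric] power_mult_distrib algebra_simps power4_eq_xxxx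
        power2_eq_square)
  then show ?thesis using \<open>d \<noteq> 0\<close> by (simp add: b_def)
qed

section \<open>The nearest-point map on the tube\<close>

text \<open>
The part of the geometry that does not depend on a parametrization: a compact set with a line
\<open>\<real> u p\<close> at each of its points, such that tangent circles have radius at least \<open>\<rho>\<close> and nearest points
see the given point in a direction orthogonal to the line. For a link, \<open>u p\<close> spans the tangent line
at \<open>p\<close>. Only the line matters; the sign of \<open>u p\<close> is an arbitrary choice at every point.
\<close>

locale thick_set =
  fixes K :: "'a::euclidean_space set" and \<rho> :: real and u :: "'a \<Rightarrow> 'a"
  assumes compact_K: "compact K" and K_ne: "K \<noteq> {}" and rho_pos: "\<rho> > 0"
    and unit: "p \<in> K \<Longrightarrow> norm (u p) = 1"
    and curvature: "p \<in> K \<Longrightarrow> q \<in> K \<Longrightarrow>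
      (2 * \<rho>)\<^sup>2 * ((norm (q - p))\<^sup>2 - ((q - p) \<bullet> u p)\<^sup>2) \<le> norm (q - p) ^ 4"
    and nearest_perp: "p \<in> K \<Longrightarrow> (\<And>q. q \<in> K \<Longrightarrow> dist x p \<le> dist x q) \<Longrightarrow> (x - p) \<bullet> u p = 0"
begin

abbreviation foot :: "'a \<Rightarrow> 'a" where "foot \<equiv> closest_point K"

lemma normal_deviation:
  assumes "p \<in> K" "q \<in> K" "v \<bullet> u p = 0"
  shows "v \<bullet> (q - p) \<le> norm v * (norm (q - p))\<^sup>2 / (2 * \<rho>)"
proof -
  define b where "b = q - p"
  define n where "n = b - (b \<bullet> u p) *\<^sub>R u p"
  have uu: "u p \<bullet> u p = 1" using unit[OF assms(1)] by (simp add: norm_eq_1)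
  have "(norm n)\<^sup>2 = (norm b)\<^sup>2 - (b \<bullet> u p)\<^sup>2"
    unfolding power2_norm_eq_inner n_def
    by (simp add: inner_diff inner_commute uu power2_eq_square)
  then have "(2 * \<rho> * norm n)\<^sup>2 \<le> ((norm b)\<^sup>2)\<^sup>2"
    using curvature[OF assms(1,2)] by (simp add: b_def power_mult_distrib flip: power_mult)
  then have "2 * \<rho> * norm n \<le> (norm b)\<^sup>2"
    by (rule power2_le_imp_le) simp
  then have n: "norm n \<le> (norm b)\<^sup>2 / (2 * \<rho>)"
    using rho_pos by (simp add: field_simps)
  have "v \<bullet> b = v \<bullet> n" using assms(3) by (simp add: n_def inner_diff_right)
  also have "\<dots> \<le> norm v * norm n" by (rule norm_cauchy_schwarz)
  also have "\<dots> \<le> norm v * ((norm b)\<^sup>2 / (2 * \<rho>))" using n by (intro mult_left_mono) auto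
  finally show ?thesis by (simp add: b_def)
qed

text \<open>
Quantitative form of the fact that \<open>p\<close> is the nearest point of \<open>K\<close> to every point of the normal disk
of radius \<open>\<rho>\<close> at \<open>p\<close>: expand \<open>|(x - p) - (q - p)|\<^sup>2\<close> and bound the mixed term by
\<open>normal_deviation\<close>.
\<close>

lemma foot_dist_sq:
  assumes "p \<in> K" "q \<in> K" "(x - p) \<bullet> u p = 0"
  shows "(dist x p)\<^sup>2 + (dist p q)\<^sup>2 * (1 - dist x p / \<rho>) \<le> (dist x q)\<^sup>2"
proof -
  have "(dist x q)\<^sup>2 = (norm ((x - p) - (q - p)))\<^sup>2" by (simp add: dist_norm)
  also have "\<dots> = (norm (x - p))\<^sup>2 + (norm (q - p))\<^sup>2 - 2 * ((x - p) \<bullet> (q - p))"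
    unfolding power2_norm_eq_inner by (simp add: inner_diff inner_commute)
  also have "\<dots> \<ge> (norm (x - p))\<^sup>2 + (norm (q - p))\<^sup>2 - 2 * (norm (x - p) * (norm (q - p))\<^sup>2 / (2 * \<rho>))"
    using normal_deviation[OF assms(1,2,3)] by linarith
  finally show ?thesis using rho_pos
    by (simp add: dist_norm norm_minus_commute algebra_simps)
qed

lemma foot_in: "foot x \<in> K" and foot_le: "q \<in> K \<Longrightarrow> dist x (foot x) \<le> dist x q"
  using closest_point_exists[OF compact_imp_closed[OF compact_K] K_ne] by auto

lemma foot_dist: "dist x (foot x) = infdist x K"
  by (intro antisym cINF_greatest infdist_le foot_in)
     (auto simp: infdist_def K_ne foot_le intro!: cINF_greatest)

lemma foot_perp: "(x - foot x) \<bullet> u (foot x) = 0"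
  by (rule nearest_perp[OF foot_in foot_le])

text \<open>
Inside the tube the fibre of \<open>foot\<close> over \<open>p\<close> is the whole normal disk at \<open>p\<close>. The isotopy relies on
this to move points without changing their feet.
\<close>

lemma foot_eqI:
  assumes "p \<in> K" "(x - p) \<bullet> u p = 0" "dist x p < \<rho>"
  shows "foot x = p"
proof (rule ccontr)
  assume "foot x \<noteq> p"
  then have "0 < (dist p (foot x))\<^sup>2 * (1 - dist x p / \<rho>)"
    using assms(3) rho_pos by (intro mult_pos_pos) auto
  then have "(dist x p)\<^sup>2 < (dist x (foot x))\<^sup>2"
    using foot_dist_sq[OF assms(1) foot_in assms(2), of x] by linarith
  moreover have "(dist x (foot x))\<^sup>2 \<le> (dist x p)\<^sup>2"
    using foot_le[OF assms(1)] by (intro power_mono) auto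
  ultimately show False by simp
qed

lemma foot_of_mem: "p \<in> K \<Longrightarrow> foot p = p"
  by (rule closest_point_self)

lemma infdist_less_iff: "infdist x K < r \<longleftrightarrow> (\<exists>p\<in>K. dist x p < r)"
  using foot_dist[of x] foot_in[of x] infdist_le[of _ K x] by (metis le_less_trans)

lemma continuous_on_foot: "continuous_on {x. infdist x K < \<rho>} foot"
proof -
  let ?S = "{x. infdist x K < \<rho>}"
  have eq: "(\<lambda>x. (x, foot x)) ` ?S = (?S \<times> K) \<inter> {z. dist (fst z) (snd z) = infdist (fst z) K}"
    (is "?L = ?R")
  proof
    show "?L \<subseteq> ?R" using foot_in foot_dist by auto
    show "?R \<subseteq> ?L"
    proof clarsimp
      fix x p assume *: "infdist x K < \<rho>" "p \<in> K" "dist x p = infdist x K"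
      then have "(x - p) \<bullet> u p = 0" by (intro nearest_perp) (auto intro: infdist_le)
      then have "foot x = p" using * by (intro foot_eqI) auto
      then show "(x, p) \<in> ?L" using * by auto
    qed
  qed
  \<comment> \<open>A map into a compact set is continuous as soon as its graph is closed.\<close>
  have "closed {z :: 'a \<times> 'a. dist (fst z) (snd z) = infdist (fst z) K}"
    by (intro closed_Collect_eq continuous_intros)
  then have "closedin (top_of_set (?S \<times> K)) ((\<lambda>x. (x, foot x)) ` ?S)"
    unfolding eq by (rule closedin_closed_Int)
  then show ?thesis
    by (subst continuous_closed_graph_eq[OF compact_K]) (auto simp: foot_in)
qed

end

section \<open>Pushing a section of the tube to its core\<close>

text \<open>
By invariance of domain the image is open. It is closed because bounded displacement makes the map
proper, so by connectedness the map is onto.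
\<close>

lemma bounded_displacement_homeomorphism:
  fixes f :: "'a::euclidean_space \<Rightarrow> 'a"
  assumes cont: "continuous_on UNIV f" and inj: "inj f" and bd: "\<And>x. dist x (f x) \<le> B"
  obtains g where "homeomorphism UNIV UNIV f g"
proof -
  have op: "open (range f)"
    by (rule invariance_of_domain[OF cont open_UNIV inj])
  have "closed (range f)"
    unfolding closed_sequential_limits
  proof clarify
    fix y l assume y: "\<forall>n. y n \<in> range f" and lim: "y \<longlonglongrightarrow> l"
    from y have "\<forall>n. \<exists>z. y n = f z" by blast
    from choice[OF this] obtain x where "\<forall>n. y n = f (x n)" by (rule exE)
    then have x: "y n = f (x n)" for n by (rule spec)
    have "bounded (range y)" using convergent_imp_bounded[OF lim] .
    then obtain C where "\<forall>v\<in>range y. norm v \<le> C" unfolding bounded_iff by (rule exE)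
    then have C: "norm (y n) \<le> C" for n by simp
    have "norm (x n) \<le> C + B" for n
      using C[of n] bd[of "x n"] x[of n] norm_triangle_sub[of "x n" "f (x n)"] by (simp add: dist_norm)
    then have "bounded (range x)" unfolding bounded_iff by blast
    then obtain z r where r: "strict_mono (r :: nat \<Rightarrow> nat)" "(x \<circ> r) \<longlonglongrightarrow> z"
      using bounded_imp_convergent_subsequence by blast
    have "isCont f z" using cont by (simp add: continuous_on_eq_continuous_at)
    then have "(\<lambda>n. f ((x \<circ> r) n)) \<longlonglongrightarrow> f z" using r(2) by (rule isCont_tendsto_compose)
    moreover have "(\<lambda>n. f ((x \<circ> r) n)) = y \<circ> r" by (rule ext) (simp only: x comp_apply)
    ultimately have "(y \<circ> r) \<longlonglongrightarrow> f z" by (simp only:)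
    then have "f z = l" using LIMSEQ_subseq_LIMSEQ[OF lim r(1)] by (rule LIMSEQ_unique)
    then show "l \<in> range f" by auto
  qed
  then have "range f = UNIV" using op clopen by blast
  moreover obtain g where "homeomorphism UNIV (range f) f g"
    using invariance_of_domain_homeomorphism[OF open_UNIV cont order_refl inj] .
  ultimately show thesis using that by simp
qed

context thick_set
begin

text \<open>
\<open>L\<close> meets every normal disk in exactly one point, \<open>q x\<close> in the disk that contains \<open>x\<close>. Within this
disk, \<open>x\<close> is moved by \<open>- t c(x) w\<close>, where \<open>w\<close> leads from the center of the disk to \<open>q x\<close> and the cutoff
\<open>c\<close> decreases linearly from \<open>1\<close> at \<open>q x\<close> to \<open>0\<close> at distance \<open>r - \<delta>\<close>. Since \<open>|w| \<le> \<delta>\<close>, the cutoff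
vanishes outside the disk of radius \<open>r\<close>; and since \<open>\<delta> < r - \<delta>\<close>, the displacement is a contraction on
each disk, so that every stage is injective. Such an \<open>r < \<rho>\<close> exists precisely because \<open>2 \<delta> < \<rho>\<close>.
\<close>

proposition isotopy_onto_core:
  assumes L: "compact L" and inj: "inj_on foot L" and im: "foot ` L = K"
    and d: "0 < \<delta>" "2 * \<delta> < \<rho>" and near: "\<And>x. x \<in> L \<Longrightarrow> dist x (foot x) \<le> \<delta>"
  obtains H :: "real \<Rightarrow> 'a \<Rightarrow> 'a"
  where "continuous_on ({0..1} \<times> UNIV) (\<lambda>(t, x). H t x)"
    "\<And>t. t \<in> {0..1} \<Longrightarrow> \<exists>G. homeomorphism UNIV UNIV (H t) G"
    "\<And>x. H 0 x = x" "H 1 ` L = K" "\<And>t x. t \<in> {0..1} \<Longrightarrow> dist x (H t x) \<le> \<delta>"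
proof -
  define r where "r = (2 * \<delta> + \<rho>) / 2"
  define \<sigma> where "\<sigma> = r - \<delta>"
  have r: "2 * \<delta> < r" "r < \<rho>" "0 < r" using d by (auto simp: r_def)
  have s: "\<delta> < \<sigma>" "0 < \<sigma>" using r d by (auto simp: \<sigma>_def)
  let ?U = "{x. infdist x K < \<rho>}"
  have openU: "open ?U" by (intro open_Collect_less continuous_intros)
  have contL: "continuous_on L foot"
    by (rule continuous_on_subset[OF continuous_on_foot])
       (use near d in \<open>auto simp flip: foot_dist dest!: near\<close>)
  obtain g where g: "homeomorphism L K foot g"
    using homeomorphism_compact[OF L contL im inj] by blast
  define q where "q x = g (foot x)" for x
  define w where "w x = q x - foot x" for x
  define c where "c x = max 0 (1 - norm (x - q x) / \<sigma>)" for x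
  define M where "M x = (if x \<in> ?U then c x *\<^sub>R w x else 0)" for x
  define H where "H t x = x - t *\<^sub>R M x" for t x
  have qL: "q x \<in> L" for x
    using g foot_in[of x] by (auto simp: q_def homeomorphism_def)
  have fq: "foot (q x) = foot x" for x
    using g foot_in[of x] by (auto simp: q_def homeomorphism_def)
  have nw: "norm (w x) \<le> \<delta>" for x
    using near[OF qL[of x]] by (simp add: fq w_def dist_norm)
  have wperp: "w x \<bullet> u (foot x) = 0" for x
    using foot_perp[of "q x"] by (simp add: fq w_def)
  have contq: "continuous_on ?U q"
    unfolding q_def
    by (rule continuous_on_compose2[OF _ continuous_on_foot])
       (use g foot_in in \<open>auto simp: homeomorphism_def\<close>)
  have contU: "continuous_on ?U (\<lambda>x. c x *\<^sub>R w x)"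
    unfolding c_def w_def using s by (intro continuous_intros contq continuous_on_foot) auto
  have chi01: "0 \<le> c x" "c x \<le> 1" for x using s by (auto simp: c_def)
  have chi0: "c x = 0" if "r \<le> infdist x K" for x
  proof -
    have "r \<le> norm (x - foot x)" using that by (simp add: dist_norm flip: foot_dist)
    also have "x - foot x = (x - q x) + w x" by (simp add: w_def)
    also have "norm \<dots> \<le> norm (x - q x) + norm (w x)" by (rule norm_triangle_ineq)
    finally have "\<sigma> \<le> norm (x - q x)" using nw[of x] by (simp add: \<sigma>_def)
    then show ?thesis using s by (simp add: c_def)
  qed
  have contM: "continuous_on UNIV M"
  proof -
    let ?V = "{x. r < infdist x K}"
    have "continuous_on ?U M"
      by (rule continuous_on_eq[OF contU]) (simp add: M_def)
    moreover have "continuous_on ?V M"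
      by (rule continuous_on_eq[OF continuous_on_const[of _ 0]]) (simp add: M_def chi0)
    moreover have "open ?V" by (intro open_Collect_less continuous_intros)
    ultimately have "continuous_on (?U \<union> ?V) M" by (intro continuous_on_open_Un openU)
    moreover have "?U \<union> ?V = UNIV" using r by auto
    ultimately show ?thesis by simp
  qed
  have nM: "norm (M x) \<le> \<delta>" for x
  proof -
    have "c x * norm (w x) \<le> 1 * \<delta>" using chi01 nw by (intro mult_mono) auto
    then show ?thesis using d chi01 by (simp add: M_def)
  qed
  have disp: "dist x (H t x) \<le> \<delta>" if "t \<in> {0..1}" for t x
  proof -
    have "t * norm (M x) \<le> 1 * \<delta>" using that nM[of x] by (intro mult_mono) auto
    then show ?thesis using that by (simp add: H_def dist_norm)
  qed
  \<comment> \<open>The isotopy preserves every normal disk, so it does not change the foot point.\<close>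
  have footH: "foot (H t x) = foot x \<and> H t x \<in> ?U" if t: "t \<in> {0..1}" and x: "x \<in> ?U" for t x
  proof -
    have "dist (H t x) (foot x) < \<rho>"
    proof (cases "c x = 0")
      case True
      then show ?thesis using x by (simp add: H_def M_def foot_dist)
    next
      case False
      then have "norm (x - q x) < \<sigma>" using s by (auto simp: c_def max_def split: if_splits)
      moreover have "H t x - foot x = (x - q x) + (1 - t * c x) *\<^sub>R w x"
        using x by (simp add: H_def M_def w_def algebra_simps)
      moreover have "norm ((1 - t * c x) *\<^sub>R w x) \<le> 1 * \<delta>"
      proof -
        have "t * c x \<le> 1" using t chi01[of x] mult_mono[of t 1 "c x" 1] by auto
        moreover have "0 \<le> t * c x" using t chi01[of x] by auto
        ultimately have "\<bar>1 - t * c x\<bar> \<le> 1" by auto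
        then have "\<bar>1 - t * c x\<bar> * norm (w x) \<le> 1 * \<delta>" using nw[of x] by (intro mult_mono) auto
        then show ?thesis by simp
      qed
      ultimately have "norm (H t x - foot x) < \<sigma> + \<delta>"
        using norm_triangle_ineq[of "x - q x" "(1 - t * c x) *\<^sub>R w x"] by simp
      then show ?thesis using r by (simp add: \<sigma>_def dist_norm)
    qed
    moreover have "(H t x - foot x) \<bullet> u (foot x) = 0"
    proof -
      have "H t x - foot x = (x - foot x) - (t * c x) *\<^sub>R w x"
        using x by (simp add: H_def M_def)
      then show ?thesis using foot_perp[of x] wperp[of x] by (simp add: inner_diff_left)
    qed
    ultimately show ?thesis
      using foot_eqI[OF foot_in[of x]] foot_in[of x] unfolding mem_Collect_eq infdist_less_iff by blast
  qed
  have injH: "inj (H t)" if t: "t \<in> {0..1}" for t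
  proof (rule injI)
    fix x y assume eq: "H t x = H t y"
    have out: "H t z = z" if "z \<notin> ?U" for z using that by (simp add: H_def M_def)
    have iff: "H t z \<in> ?U \<longleftrightarrow> z \<in> ?U" for z
      using footH[OF t, of z] out[of z] by (cases "z \<in> ?U") auto
    have "x \<in> ?U \<longleftrightarrow> y \<in> ?U"
      using iff[of x] iff[of y] unfolding eq by (rule trans[OF sym])
    then consider "x \<in> ?U" "y \<in> ?U" | "x \<notin> ?U" "y \<notin> ?U" by blast
    then show "x = y"
    proof cases
      case 1
      have fxy: "foot x = foot y" using footH[OF t 1(1)] footH[OF t 1(2)] eq by simp
      then have qw: "q x = q y" "w x = w y" by (simp_all add: q_def w_def)
      have "x - y = (t * (c x - c y)) *\<^sub>R w y"
        using eq 1 qw by (simp add: H_def M_def algebra_simps)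
      then have n: "norm (x - y) = t * (\<bar>c x - c y\<bar> * norm (w y))" using t by (simp add: abs_mult)
      \<comment> \<open>On one disk \<open>c\<close> has Lipschitz constant \<open>1 / \<sigma>\<close>, and \<open>|w| \<le> \<delta> < \<sigma>\<close>.\<close>
      have "\<bar>c x - c y\<bar> \<le> \<bar>norm (x - q x) / \<sigma> - norm (y - q y) / \<sigma>\<bar>"
        unfolding c_def by linarith
      also have "\<dots> = \<bar>norm (x - q y) - norm (y - q y)\<bar> / \<sigma>"
        using s by (simp add: qw flip: diff_divide_distrib)
      also have "\<dots> \<le> norm (x - y) / \<sigma>"
        using s norm_triangle_ineq3[of "x - q y" "y - q y"] by (intro divide_right_mono) auto
      finally have "\<bar>c x - c y\<bar> * norm (w y) \<le> norm (x - y) / \<sigma> * \<delta>"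
        using s nw[of y] by (intro mult_mono) auto
      moreover have "norm (x - y) \<le> \<bar>c x - c y\<bar> * norm (w y)"
        unfolding n using t by (intro mult_left_le_one_le) auto
      ultimately have "norm (x - y) \<le> norm (x - y) * (\<delta> / \<sigma>)" by simp
      moreover have "norm (x - y) * (\<delta> / \<sigma>) < norm (x - y) * 1" if "x \<noteq> y"
        using s that by (intro mult_strict_left_mono) auto
      ultimately show ?thesis by fastforce
    next
      case 2
      then show ?thesis using eq out by simp
    qed
  qed
  have contH: "continuous_on ({0..1} \<times> UNIV) (\<lambda>(t, x). H t x)"
    unfolding H_def case_prod_beta
    by (intro continuous_intros continuous_on_compose2[OF contM]) auto
  have "continuous_on UNIV (H t)" for t
    unfolding H_def by (intro continuous_intros contM)
  then have homeo: "\<exists>G. homeomorphism UNIV UNIV (H t) G" if "t \<in> {0..1}" for t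
    using bounded_displacement_homeomorphism[OF _ injH[OF that] disp[OF that]] by metis
  have H1: "H 1 x = foot x" if "x \<in> L" for x
  proof -
    have "q x = x" using that g by (auto simp: q_def homeomorphism_def)
    moreover have "x \<in> ?U" using near[OF that] d by (simp add: foot_dist)
    ultimately show ?thesis by (simp add: H_def M_def c_def w_def)
  qed
  have "H 1 ` L = K" using H1 im by force
  then show thesis using that[of H] contH homeo disp by (simp add: H_def)
qed

end

section \<open>Simple loops and their lifts\<close>

lemma simple_loop_shift: "simple_loop \<gamma> \<Longrightarrow> \<gamma> (t + of_int n) = \<gamma> t"
proof -
  assume *: "simple_loop \<gamma>"
  have nat: "\<gamma> (s + of_nat m) = \<gamma> s" for s and m :: nat
  proof (induction m)
    case (Suc m)
    have "\<gamma> ((s + of_nat m) + 1) = \<gamma> (s + of_nat m)" using * unfolding simple_loop_def by blast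
    then show ?case using Suc by (simp add: algebra_simps)
  qed simp
  show ?thesis
  proof (cases "n \<ge> 0")
    case True
    then show ?thesis using nat[of t "nat n"] by simp
  next
    case False
    then show ?thesis using nat[of "t + of_int n" "nat (- n)"] by simp
  qed
qed

lemma simple_loop_eq_iff:
  assumes "simple_loop \<gamma>"
  shows "\<gamma> x = \<gamma> y \<longleftrightarrow> x - y \<in> \<int>"
proof
  assume "x - y \<in> \<int>"
  then obtain n where "x = y + of_int n" by (auto elim!: Ints_cases simp: algebra_simps)
  then show "\<gamma> x = \<gamma> y" using simple_loop_shift[OF assms] by simp
next
  assume eq: "\<gamma> x = \<gamma> y"
  have fr: "\<gamma> z = \<gamma> (frac z)" for z
    using simple_loop_shift[OF assms, of "frac z" "\<lfloor>z\<rfloor>"] by (simp add: frac_def)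
  have "frac x \<in> {0..1}" "frac y \<in> {0..1}" "frac x < 1" "frac y < 1"
    using frac_lt_1[of x] frac_lt_1[of y] by (auto intro: less_imp_le)
  moreover have "loop_free \<gamma>" using assms by (simp add: simple_loop_def simple_path_def)
  moreover have "\<gamma> (frac x) = \<gamma> (frac y)" by (rule trans[OF trans[OF fr[symmetric] eq] fr])
  ultimately have "frac x = frac y"
    unfolding loop_free_def by fastforce
  then have "x - y = of_int (\<lfloor>x\<rfloor> - \<lfloor>y\<rfloor>)" by (simp add: frac_def)
  then show "x - y \<in> \<int>" using Ints_of_int by metis
qed

lemma simple_loop_range: "simple_loop \<gamma> \<Longrightarrow> range \<gamma> = path_image \<gamma>"
proof -
  assume *: "simple_loop \<gamma>"
  have "\<gamma> z \<in> \<gamma> ` {0..1}" for z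
  proof -
    have "\<gamma> z = \<gamma> (frac z)"
      using simple_loop_shift[OF *, of "frac z" "\<lfloor>z\<rfloor>"] by (simp add: frac_def)
    moreover have "frac z \<in> {0..1}" using frac_lt_1[of z] by (auto intro: less_imp_le)
    ultimately show ?thesis by blast
  qed
  then show ?thesis by (auto simp: path_image_def)
qed

lemma simple_loop_reverse:
  assumes "simple_loop \<gamma>"
  shows "simple_loop (\<lambda>t. \<gamma> (- t))"
proof -
  have "\<gamma> (1 - t) = \<gamma> (- t)" for t
    using simple_loop_shift[OF assms, of "-t" 1] by (simp add: algebra_simps)
  then have "(\<lambda>t. \<gamma> (- t)) = reversepath \<gamma>" by (auto simp: reversepath_def)
  moreover have "simple_path (reversepath \<gamma>)"
    using assms unfolding simple_loop_def by (blast intro: simple_path_reversepath)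
  ultimately have "simple_path (\<lambda>t. \<gamma> (- t))" by (simp only:)
  moreover have "\<gamma> (- (t + 1)) = \<gamma> (- t)" for t
    using simple_loop_shift[OF assms, of "-t" "-1"] by (simp add: algebra_simps)
  ultimately show ?thesis unfolding simple_loop_def by blast
qed

lemma cis_two_pi_eq_iff: "cis (2 * pi * x) = cis (2 * pi * y) \<longleftrightarrow> x - y \<in> \<int>"
proof -
  have "cis (2 * pi * x) = cis (2 * pi * y) \<longleftrightarrow> cis (2 * pi * (x - y)) = 1"
    by (simp add: right_diff_distrib flip: cis_divide)
  also have "\<dots> \<longleftrightarrow> (\<exists>n::int. 2 * pi * (x - y) = of_int n * 2 * pi)"
    by (auto simp: cis_conv_exp exp_eq_1 simp flip: of_real_mult of_real_diff)
  also have "\<dots> \<longleftrightarrow> x - y \<in> \<int>"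
  proof -
    have "2 * pi * (x - y) = of_int n * 2 * pi \<longleftrightarrow> x - y = of_int n" for n :: int by auto
    then show ?thesis by (auto simp: Ints_def)
  qed
  finally show ?thesis .
qed

text \<open>
The map \<open>e\<close> that sends \<open>\<kappa> t\<close> to \<open>cis (2 \<pi> t)\<close> identifies the loop with the unit circle, and a
continuous logarithm of \<open>e \<circ> g\<close> exists on a contractible set. The lift is its imaginary part, scaled.
\<close>

lemma simple_loop_lift:
  fixes g :: "'a::real_normed_vector \<Rightarrow> real^3"
  assumes "simple_loop \<kappa>" and g: "continuous_on S g" "g ` S \<subseteq> path_image \<kappa>" and "contractible S"
  obtains f where "continuous_on S f" "\<And>x. x \<in> S \<Longrightarrow> g x = \<kappa> (f x)"
proof -
  define e where "e p = cis (2 * pi * (SOME t. \<kappa> t = p))" for p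
  have e: "e (\<kappa> t) = cis (2 * pi * t)" for t
  proof -
    have "\<kappa> (SOME s. \<kappa> s = \<kappa> t) = \<kappa> t" by (rule someI) simp
    then show ?thesis unfolding e_def cis_two_pi_eq_iff using simple_loop_eq_iff[OF assms(1)] by blast
  qed
  \<comment> \<open>\<open>\<kappa>\<close> maps the compact unit interval onto the loop, so \<open>e\<close> is continuous because \<open>e \<circ> \<kappa>\<close> is.\<close>
  have cont_e: "continuous_on (path_image \<kappa>) e"
    unfolding continuous_on_closed_invariant
  proof (intro allI impI)
    fix C :: "complex set" assume C: "closed C"
    have "continuous_on {0..1} (\<lambda>t. cis (2 * pi * t))" by (intro continuous_intros)
    then have "closed ({0..1} \<inter> (\<lambda>t. cis (2 * pi * t)) -` C)"
      by (rule continuous_closed_preimage[OF _ closed_atLeastAtMost C])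
    then have "compact ({0..1} \<inter> (\<lambda>t. cis (2 * pi * t)) -` C)"
      by (metis Int_left_absorb compact_Icc compact_Int_closed)
    moreover have "continuous_on {0..1} \<kappa>"
      using assms(1) by (simp add: simple_loop_def simple_path_def path_def)
    ultimately have "compact (\<kappa> ` ({0..1} \<inter> (\<lambda>t. cis (2 * pi * t)) -` C))"
      by (meson compact_continuous_image continuous_on_subset inf_le1)
    moreover have "\<kappa> ` ({0..1} \<inter> (\<lambda>t. cis (2 * pi * t)) -` C) \<inter> path_image \<kappa> = e -` C \<inter> path_image \<kappa>"
    proof (intro equalityI subsetI)
      fix p assume "p \<in> \<kappa> ` ({0..1} \<inter> (\<lambda>t. cis (2 * pi * t)) -` C) \<inter> path_image \<kappa>"
      then show "p \<in> e -` C \<inter> path_image \<kappa>" by (auto simp: e)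
    next
      fix p assume *: "p \<in> e -` C \<inter> path_image \<kappa>"
      then obtain t where t: "t \<in> {0..1}" "p = \<kappa> t" by (auto simp: path_image_def)
      then have "t \<in> {0..1} \<inter> (\<lambda>t. cis (2 * pi * t)) -` C" using * by (simp add: e)
      then show "p \<in> \<kappa> ` ({0..1} \<inter> (\<lambda>t. cis (2 * pi * t)) -` C) \<inter> path_image \<kappa>"
        using t * by blast
    qed
    ultimately show "\<exists>A. closed A \<and> A \<inter> path_image \<kappa> = e -` C \<inter> path_image \<kappa>"
      using compact_imp_closed by blast
  qed
  have "continuous_on S (\<lambda>x. e (g x))"
    by (rule continuous_on_compose2[OF cont_e g])
  moreover have "e (g x) \<noteq> 0" for x by (simp add: e_def)
  ultimately obtain h where h: "continuous_on S h" "\<And>x. x \<in> S \<Longrightarrow> e (g x) = exp (h x)"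
    using continuous_logarithm_on_contractible[OF _ assms(4)] by blast
  show thesis
  proof (rule that)
    show "continuous_on S (\<lambda>x. Im (h x) / (2 * pi))" by (intro continuous_intros h) auto
    fix x assume x: "x \<in> S"
    then obtain t where t: "g x = \<kappa> t" using g(2) by (auto simp: path_image_def)
    have "norm (exp (h x)) = 1" unfolding h(2)[OF x, symmetric] by (simp add: e_def)
    then have "Re (h x) = 0" by simp
    then have "exp (h x) = cis (Im (h x))" by (simp add: exp_eq_polar)
    then have "cis (2 * pi * t) = cis (2 * pi * (Im (h x) / (2 * pi)))"
      using h(2)[OF x] e t by simp
    then have "t - Im (h x) / (2 * pi) \<in> \<int>" by (simp only: cis_two_pi_eq_iff)
    then show "g x = \<kappa> (Im (h x) / (2 * pi))"
      unfolding t using simple_loop_eq_iff[OF assms(1)] by blast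
  qed
qed

text \<open>
Both loops are injective modulo integers, so \<open>\<phi> x - \<phi> y\<close> is an integer only if \<open>x - y\<close> is. In particular
the total increment \<open>m\<close> is an integer. The intermediate value theorem excludes \<open>|m| \<ge> 2\<close>, where \<open>\<phi>\<close>
would take the value \<open>\<phi> 0 \<plusminus> 1\<close> inside the interval, and \<open>m = 0\<close>, where it would take some value twice.
\<close>

lemma lift_of_simple_loop_monotone:
  assumes \<gamma>: "simple_loop \<gamma>" and \<kappa>: "simple_loop \<kappa>"
    and cont: "continuous_on {0..1} \<phi>" and lift: "\<And>t. t \<in> {0..1} \<Longrightarrow> \<gamma> t = \<kappa> (\<phi> t)"
  shows "(strict_mono_on {0..1} \<phi> \<and> \<phi> 1 = \<phi> 0 + 1) \<or> (strict_antimono_on {0..1} \<phi> \<and> \<phi> 1 = \<phi> 0 - 1)"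
proof -
  have iff: "\<phi> x - \<phi> y \<in> \<int> \<longleftrightarrow> x - y \<in> \<int>" if "x \<in> {0..1}" "y \<in> {0..1}" for x y
    using simple_loop_eq_iff[OF \<gamma>, of x y] simple_loop_eq_iff[OF \<kappa>, of "\<phi> x" "\<phi> y"] lift that by metis
  have small: "x = y" if "x - y \<in> \<int>" "\<bar>x - y\<bar> < 1" for x y :: real
    using that Ints_nonzero_abs_ge1[of "x - y"] by auto
  have near: "x = y" if "x \<in> {0..1}" "y \<in> {0..1}" "\<phi> x - \<phi> y \<in> \<int>" "\<bar>x - y\<bar> < 1" for x y
    using iff small that by blast
  have "\<phi> 1 - \<phi> 0 \<in> \<int>" using iff[of 1 0] by simp
  then obtain m where m: "\<phi> 1 - \<phi> 0 = of_int m" by (auto elim: Ints_cases)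
  have ivt: "\<exists>x\<in>{a..b}. \<phi> x = v" if "0 \<le> a" "a \<le> b" "b \<le> 1" "\<phi> a \<le> v \<and> v \<le> \<phi> b \<or> \<phi> b \<le> v \<and> v \<le> \<phi> a" for a b v
  proof -
    have c: "continuous_on {a..b} \<phi>" by (rule continuous_on_subset[OF cont]) (use that in auto)
    show ?thesis
      using IVT'[of \<phi> a v b] IVT2'[of \<phi> b v a] that c by (metis atLeastAtMost_iff)
  qed
  \<comment> \<open>A value at integer distance from \<open>\<phi> 0\<close> can only be taken at the end points.\<close>
  have m1: "\<bar>m\<bar> \<le> 1"
  proof (rule ccontr)
    assume "\<not> \<bar>m\<bar> \<le> 1"
    then have "2 \<le> m \<or> m \<le> - 2" by linarith
    then have "2 \<le> real_of_int m \<or> real_of_int m \<le> - 2" by linarith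
    then have "\<exists>s. (s = 1 \<or> s = - 1) \<and> (\<phi> 0 \<le> \<phi> 0 + s \<and> \<phi> 0 + s \<le> \<phi> 1 \<or> \<phi> 1 \<le> \<phi> 0 + s \<and> \<phi> 0 + s \<le> \<phi> 0)
       \<and> \<phi> 0 + s \<noteq> \<phi> 1"
    proof
      assume "2 \<le> real_of_int m"
      then show ?thesis using m by (intro exI[of _ 1]) auto
    next
      assume "real_of_int m \<le> - 2"
      then show ?thesis using m by (intro exI[of _ "- 1"]) auto
    qed
    then obtain s where s: "s = 1 \<or> s = - 1" "\<phi> 0 \<le> \<phi> 0 + s \<and> \<phi> 0 + s \<le> \<phi> 1 \<or> \<phi> 1 \<le> \<phi> 0 + s \<and> \<phi> 0 + s \<le> \<phi> 0"
       "\<phi> 0 + s \<noteq> \<phi> 1" by blast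
    have "\<exists>x\<in>{0..1}. \<phi> x = \<phi> 0 + s" by (rule ivt) (use s(2) in auto)
    then obtain x where x: "x \<in> {0..1}" "\<phi> x = \<phi> 0 + s" by blast
    have "\<phi> x - \<phi> 0 \<in> \<int>" using x s(1) by auto
    moreover have "x \<noteq> 1" using x s by auto
    ultimately have "x = 0" using near[of x 0] x by auto
    then show False using x s by auto
  qed
  have m0: "m \<noteq> 0"
  proof
    assume "m = 0"
    then have eq: "\<phi> 1 = \<phi> 0" using m by simp
    define v where "v = (\<phi> 0 + \<phi> (1/2)) / 2"
    have v: "\<phi> 0 \<le> v \<and> v \<le> \<phi> (1/2) \<or> \<phi> (1/2) \<le> v \<and> v \<le> \<phi> 0"
      by (cases "\<phi> 0 \<le> \<phi> (1/2)") (auto simp: v_def)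
    have "\<exists>x\<in>{0..1/2}. \<phi> x = v" by (rule ivt) (use v in auto)
    then obtain x where x: "x \<in> {0..1/2}" "\<phi> x = v" by blast
    have "\<exists>x\<in>{1/2..1}. \<phi> x = v" by (rule ivt) (use v eq in auto)
    then obtain y where y: "y \<in> {1/2..1}" "\<phi> y = v" by blast
    have "\<phi> (1/2) \<noteq> \<phi> 0" using near[of "1/2" 0] by auto
    then have "v \<noteq> \<phi> 0" "v \<noteq> \<phi> (1/2)" by (auto simp: v_def field_simps)
    then have "x \<noteq> 0" "x \<noteq> 1/2" "y \<noteq> 1/2" using x(2) y(2) by metis+
    then show False using near[of x y] x y by auto
  qed
  have "inj_on \<phi> {0..1}"
  proof (rule inj_onI)
    fix x y assume *: "x \<in> {0..1}" "y \<in> {0..1}" "\<phi> x = \<phi> y"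
    show "x = y"
    proof (cases "\<bar>x - y\<bar> < 1")
      case True
      then show ?thesis using near[of x y] * by simp
    next
      case False
      then have "x = 0 \<and> y = 1 \<or> x = 1 \<and> y = 0" using *(1,2) by auto
      then show ?thesis using *(3) m m0 by auto
    qed
  qed
  then have mono: "strict_mono_on {0..1} \<phi> \<or> strict_antimono_on {0..1} \<phi>"
    using injective_eq_monotone_map[OF _ cont] by (simp add: is_interval_cc)
  have "m = 1 \<or> m = - 1" using m0 m1 by linarith
  then have "\<phi> 1 = \<phi> 0 + 1 \<or> \<phi> 1 = \<phi> 0 - 1" using m by auto
  moreover have "\<phi> 0 < \<phi> 1" if "strict_mono_on {0..1} \<phi>"
    using monotone_onD[OF that, of 0 1] by simp
  moreover have "\<phi> 1 < \<phi> 0" if "strict_antimono_on {0..1} \<phi>"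
    using monotone_onD[OF that, of 0 1] by simp
  ultimately show ?thesis using mono by linarith
qed

section \<open>Arc length\<close>

lemma inscribed_lengthsE:
  assumes "x \<in> inscribed_lengths \<gamma> a b"
  obtains m :: nat and p where "x = (\<Sum>k<m. dist (\<gamma> (p k)) (\<gamma> (p (Suc k))))"
    "mono_on {..m} p" "p ` {..m} \<subseteq> {a..b}"
  using assms unfolding inscribed_lengths_def mem_Collect_eq by (elim exE conjE) (rule that)

lemma inscribed_lengthsI:
  assumes "mono_on {..m} p" "p ` {..m} \<subseteq> {a..b}"
  shows "(\<Sum>k<m. dist (\<gamma> (p k)) (\<gamma> (p (Suc k)))) \<in> inscribed_lengths \<gamma> a b"
  unfolding inscribed_lengths_def mem_Collect_eq
  by (rule exI[of _ m], rule exI[of _ p]) (use assms in simp)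

lemma inscribed_lengths_nonempty: "a \<le> b \<Longrightarrow> inscribed_lengths \<gamma> a b \<noteq> {}"
proof -
  assume "a \<le> b"
  then have "(\<Sum>k<0. dist (\<gamma> ((\<lambda>_. a) k)) (\<gamma> ((\<lambda>_. a) (Suc k)))) \<in> inscribed_lengths \<gamma> a b"
    by (intro inscribed_lengthsI) (auto simp: monotone_on_def)
  then show ?thesis by blast
qed

lemma inscribed_lengths_mono: "a' \<le> a \<Longrightarrow> b \<le> b' \<Longrightarrow> inscribed_lengths \<gamma> a b \<subseteq> inscribed_lengths \<gamma> a' b'"
  unfolding inscribed_lengths_def by fastforce

lemma arc_length_add_chord_le:
  assumes rect: "rectifiable \<gamma>" and st: "0 \<le> s" "s \<le> t" "t \<le> 1"
  shows "arc_length \<gamma> 0 s + dist (\<gamma> s) (\<gamma> t) \<le> arc_length \<gamma> 0 t"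
proof -
  have bdd: "bdd_above (inscribed_lengths \<gamma> 0 t)"
    using rect inscribed_lengths_mono[of 0 0 t 1] st unfolding rectifiable_def
    by (meson bdd_above_mono order_refl)
  have "arc_length \<gamma> 0 s \<le> arc_length \<gamma> 0 t - dist (\<gamma> s) (\<gamma> t)"
    unfolding arc_length_def[of \<gamma> 0 s]
  proof (rule cSup_least[OF inscribed_lengths_nonempty[OF st(1)]])
    fix x assume "x \<in> inscribed_lengths \<gamma> 0 s"
    then obtain m :: nat and p where x: "x = (\<Sum>k<m. dist (\<gamma> (p k)) (\<gamma> (p (Suc k))))"
      and p: "mono_on {..m} p" "p ` {..m} \<subseteq> {0..s}"
      by (rule inscribed_lengthsE)
    define p' where "p' k = (if k \<le> m then p k else if k = Suc m then s else t)" for k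
    have "(\<Sum>k<Suc (Suc m). dist (\<gamma> (p' k)) (\<gamma> (p' (Suc k)))) \<in> inscribed_lengths \<gamma> 0 t"
    proof (rule inscribed_lengthsI)
      have *: "0 \<le> p k" "p k \<le> s" if "k \<le> m" for k using p(2) that by auto
      show "mono_on {..Suc (Suc m)} p'"
      proof (rule mono_onI)
        fix i j assume "i \<in> {..Suc (Suc m)}" "j \<in> {..Suc (Suc m)}" "i \<le> j"
        then show "p' i \<le> p' j"
          using p(1) st *[of i] by (auto simp: p'_def monotone_on_def)
      qed
      show "p' ` {..Suc (Suc m)} \<subseteq> {0..t}" using * st by (force simp: p'_def)
    qed
    then have "(\<Sum>k<Suc (Suc m). dist (\<gamma> (p' k)) (\<gamma> (p' (Suc k)))) \<le> arc_length \<gamma> 0 t"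
      unfolding arc_length_def by (rule cSup_upper[OF _ bdd])
    moreover have "(\<Sum>k<Suc (Suc m). dist (\<gamma> (p' k)) (\<gamma> (p' (Suc k)))) = x + dist (\<gamma> (p m)) (\<gamma> s) + dist (\<gamma> s) (\<gamma> t)"
      by (simp add: p'_def x)
    moreover have "0 \<le> dist (\<gamma> (p m)) (\<gamma> s)" by simp
    ultimately show "x \<le> arc_length \<gamma> 0 t - dist (\<gamma> s) (\<gamma> t)" by linarith
  qed
  then show ?thesis by simp
qed

lemma chord_le_arc_length_difference:
  assumes "rectifiable \<gamma>" "s \<in> {0..1}" "t \<in> {0..1}"
  shows "dist (\<gamma> s) (\<gamma> t) \<le> \<bar>arc_length \<gamma> 0 s - arc_length \<gamma> 0 t\<bar>"
proof (cases "s \<le> t")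
  case True
  then show ?thesis using arc_length_add_chord_le[OF assms(1), of s t] assms by auto
next
  case False
  then show ?thesis using arc_length_add_chord_le[OF assms(1), of t s] assms by (auto simp: dist_commute)
qed

text \<open>
By the chord estimate, \<open>g\<close> factors on \<open>E\<close> through the arc length of \<open>\<gamma>\<close>, with a Lipschitz factor, and
Lipschitz functions preserve null sets.
\<close>

lemma length_null_lipschitz_image:
  fixes g :: "real \<Rightarrow> real"
  assumes rect: "rectifiable \<gamma>" and E: "E \<subseteq> {0..1}" "length_null \<gamma> E" and "B \<ge> 0"
    and lip: "\<And>s t. s \<in> E \<Longrightarrow> t \<in> E \<Longrightarrow> dist (g s) (g t) \<le> B * dist (\<gamma> s) (\<gamma> t)"
  shows "negligible (g ` E)"
proof -
  let ?S = "arc_length \<gamma> 0"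
  have lip': "dist (g s) (g t) \<le> B * \<bar>?S s - ?S t\<bar>" if "s \<in> E" "t \<in> E" for s t
  proof -
    have "B * dist (\<gamma> s) (\<gamma> t) \<le> B * \<bar>?S s - ?S t\<bar>"
      using E(1) that \<open>B \<ge> 0\<close> by (intro mult_left_mono chord_le_arc_length_difference[OF rect]) auto
    then show ?thesis using lip[OF that] by linarith
  qed
  define c where "c = inv_into E ?S"
  have c: "c y \<in> E" "?S (c y) = y" if "y \<in> ?S ` E" for y
    using that by (auto simp: c_def inv_into_into f_inv_into_f)
  have "negligible ((\<lambda>y. g (c y)) ` (?S ` E))"
  proof (rule negligible_locally_Lipschitz_image)
    show "negligible (?S ` E)" using E(2) by (simp add: length_null_def)
    fix x assume x: "x \<in> ?S ` E"
    show "\<exists>T B. open T \<and> x \<in> T \<and> (\<forall>y\<in>?S ` E \<inter> T. norm (g (c y) - g (c x)) \<le> B * norm (y - x))"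
      using lip'[OF c(1) c(1)[OF x]] c(2) c(2)[OF x]
      by (intro exI[of _ UNIV] exI[of _ B]) (auto simp: dist_norm)
  qed simp
  moreover have "g ` E \<subseteq> (\<lambda>y. g (c y)) ` (?S ` E)"
  proof
    fix z assume "z \<in> g ` E"
    then obtain s where s: "s \<in> E" "z = g s" by blast
    then have "g (c (?S s)) = g s" using lip'[of "c (?S s)" s] c[of "?S s"] by auto
    then show "z \<in> (\<lambda>y. g (c y)) ` (?S ` E)" using s by force
  qed
  ultimately show ?thesis by (rule negligible_subset)
qed

lemma bdd_inscribed_lengths_combine:
  assumes "bdd_above (inscribed_lengths \<gamma> a b)" "bdd_above (inscribed_lengths \<gamma> b c)" "a \<le> b" "b \<le> c"
  shows "bdd_above (inscribed_lengths \<gamma> a c)"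
proof -
  obtain A B where A: "\<And>x. x \<in> inscribed_lengths \<gamma> a b \<Longrightarrow> x \<le> A"
    and B: "\<And>x. x \<in> inscribed_lengths \<gamma> b c \<Longrightarrow> x \<le> B"
    using assms unfolding bdd_above_def by blast
  show ?thesis
  proof (rule bdd_aboveI)
    fix x assume "x \<in> inscribed_lengths \<gamma> a c"
    then obtain m :: nat and p where x: "x = (\<Sum>k<m. dist (\<gamma> (p k)) (\<gamma> (p (Suc k))))"
      and p: "mono_on {..m} p" "p ` {..m} \<subseteq> {a..c}"
      by (rule inscribed_lengthsE)
    \<comment> \<open>Clamping the vertices at \<open>b\<close> from above and from below gives two inscribed polygons; an edge that
       crosses \<open>b\<close> is shorter than its two parts together.\<close>
    let ?p1 = "\<lambda>k. min (p k) b" and ?p2 = "\<lambda>k. max (p k) b"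
    have "x \<le> (\<Sum>k<m. dist (\<gamma> (?p1 k)) (\<gamma> (?p1 (Suc k))) + dist (\<gamma> (?p2 k)) (\<gamma> (?p2 (Suc k))))"
      unfolding x
    proof (rule sum_mono)
      fix k assume "k \<in> {..<m}"
      then have "p k \<le> p (Suc k)" using p(1) by (auto simp: monotone_on_def)
      then show "dist (\<gamma> (p k)) (\<gamma> (p (Suc k)))
          \<le> dist (\<gamma> (?p1 k)) (\<gamma> (?p1 (Suc k))) + dist (\<gamma> (?p2 k)) (\<gamma> (?p2 (Suc k)))"
        using dist_triangle[of "\<gamma> (p k)" "\<gamma> (p (Suc k))" "\<gamma> b"] by (auto simp: min_def max_def)
    qed
    also have "\<dots> = (\<Sum>k<m. dist (\<gamma> (?p1 k)) (\<gamma> (?p1 (Suc k)))) + (\<Sum>k<m. dist (\<gamma> (?p2 k)) (\<gamma> (?p2 (Suc k))))"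
      by (rule sum.distrib)
    also have "\<dots> \<le> A + B"
    proof (rule add_mono)
      show "(\<Sum>k<m. dist (\<gamma> (?p1 k)) (\<gamma> (?p1 (Suc k)))) \<le> A"
      proof (rule A, unfold inscribed_lengths_def, intro CollectI exI conjI)
        show "mono_on {..m} ?p1" using p(1) by (fastforce simp: monotone_on_def min_def)
        show "?p1 ` {..m} \<subseteq> {a..b}" using p(2) assms(3) by auto
      qed simp
      show "(\<Sum>k<m. dist (\<gamma> (?p2 k)) (\<gamma> (?p2 (Suc k)))) \<le> B"
      proof (rule B, unfold inscribed_lengths_def, intro CollectI exI conjI)
        show "mono_on {..m} ?p2" using p(1) by (fastforce simp: monotone_on_def max_def)
        show "?p2 ` {..m} \<subseteq> {b..c}" using p(2) assms(4) by auto
      qed simp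
    qed
    finally show "x \<le> A + B" .
  qed
qed

lemma inscribed_lengths_shift:
  assumes "simple_loop \<gamma>"
  shows "inscribed_lengths \<gamma> (of_int n) (of_int n + 1) \<subseteq> inscribed_lengths \<gamma> 0 1"
proof
  fix x assume "x \<in> inscribed_lengths \<gamma> (of_int n) (of_int n + 1)"
  then obtain m :: nat and p where x: "x = (\<Sum>k<m. dist (\<gamma> (p k)) (\<gamma> (p (Suc k))))"
      and p: "mono_on {..m} p" "p ` {..m} \<subseteq> {of_int n..of_int n + 1}"
      by (rule inscribed_lengthsE)
  have sh: "\<gamma> (t - of_int n) = \<gamma> t" for t
    using simple_loop_shift[OF assms, of t "- n"] by simp
  show "x \<in> inscribed_lengths \<gamma> 0 1"
    unfolding inscribed_lengths_def
  proof (intro CollectI exI conjI)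
    show "x = (\<Sum>k<m. dist (\<gamma> (p k - of_int n)) (\<gamma> (p (Suc k) - of_int n)))" by (simp add: sh x)
    show "mono_on {..m} (\<lambda>k. p k - of_int n)" using p(1) by (auto simp: monotone_on_def)
    show "(\<lambda>k. p k - of_int n) ` {..m} \<subseteq> {0..1}" using p(2) by (auto simp: algebra_simps)
  qed
qed

lemma rectifiable_reparametrized:
  assumes bdd: "bdd_above (inscribed_lengths \<kappa> c d)"
    and \<phi>: "mono_on {0..1} \<phi> \<or> antimono_on {0..1} \<phi>" "\<phi> ` {0..1} \<subseteq> {c..d}"
    and eq: "\<And>t. t \<in> {0..1} \<Longrightarrow> \<gamma> t = \<kappa> (\<phi> t)"
  shows "rectifiable \<gamma>"
proof -
  have "inscribed_lengths \<gamma> 0 1 \<subseteq> inscribed_lengths \<kappa> c d"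
  proof
    fix x assume "x \<in> inscribed_lengths \<gamma> 0 1"
    then obtain m :: nat and p where x: "x = (\<Sum>k<m. dist (\<gamma> (p k)) (\<gamma> (p (Suc k))))"
      and p: "mono_on {..m} p" "p ` {..m} \<subseteq> {0..1}"
      by (rule inscribed_lengthsE)
    have x': "x = (\<Sum>k<m. dist (\<kappa> (\<phi> (p k))) (\<kappa> (\<phi> (p (Suc k)))))"
      unfolding x by (intro sum.cong refl) (use p(2) eq in \<open>auto simp: image_subset_iff\<close>)
    from \<phi>(1) show "x \<in> inscribed_lengths \<kappa> c d"
    proof
      assume mono: "mono_on {0..1} \<phi>"
      show ?thesis
        unfolding inscribed_lengths_def
      proof (intro CollectI exI conjI)
        show "x = (\<Sum>k<m. dist (\<kappa> ((\<lambda>k. \<phi> (p k)) k)) (\<kappa> ((\<lambda>k. \<phi> (p k)) (Suc k))))" by (fact x')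
        show "mono_on {..m} (\<lambda>k. \<phi> (p k))"
          using p mono by (auto simp: monotone_on_def image_subset_iff)
        show "(\<lambda>k. \<phi> (p k)) ` {..m} \<subseteq> {c..d}" using p(2) \<phi>(2) by (auto simp: image_subset_iff)
      qed
    next
      assume anti: "antimono_on {0..1} \<phi>"
      let ?q = "\<lambda>k. \<phi> (p (m - k))"
      show ?thesis
        unfolding inscribed_lengths_def
      proof (intro CollectI exI conjI)
        have "x = (\<Sum>k<m. dist (\<kappa> (\<phi> (p (m - Suc k)))) (\<kappa> (\<phi> (p (Suc (m - Suc k))))))"
          unfolding x' by (rule sum.nat_diff_reindex[symmetric])
        also have "\<dots> = (\<Sum>k<m. dist (\<kappa> (?q k)) (\<kappa> (?q (Suc k))))"
          by (intro sum.cong refl) (simp add: Suc_diff_Suc dist_commute)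
        finally show "x = (\<Sum>k<m. dist (\<kappa> (?q k)) (\<kappa> (?q (Suc k))))" .
        show "mono_on {..m} ?q"
        proof (rule mono_onI)
          fix i j assume "i \<in> {..m}" "j \<in> {..m}" "i \<le> j"
          then have "p (m - j) \<le> p (m - i)" "p (m - j) \<in> {0..1}" "p (m - i) \<in> {0..1}"
            using p by (auto simp: monotone_on_def image_subset_iff)
          then show "?q i \<le> ?q j" using anti by (auto simp: monotone_on_def)
        qed
        show "?q ` {..m} \<subseteq> {c..d}" using p(2) \<phi>(2) by (auto simp: image_subset_iff)
      qed
    qed
  qed
  then show ?thesis unfolding rectifiable_def by (rule bdd_above_mono[OF bdd])
qed

lemma simple_loop_continuous_on: "simple_loop \<gamma> \<Longrightarrow> continuous_on {0..1} \<gamma>"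
  by (simp add: simple_loop_def simple_path_def path_def)

text \<open>
Finite length does not depend on the parametrization: a parametrization of the same curve is a monotone
reparametrization, up to a shift of the base point. The shift is why \<open>\<kappa>\<close> is considered on two
consecutive periods.
\<close>

lemma rectifiable_within_rectifiable:
  assumes \<gamma>: "simple_loop \<gamma>" and \<kappa>: "simple_loop \<kappa>" and sub: "path_image \<gamma> \<subseteq> path_image \<kappa>"
    and rect: "rectifiable \<kappa>"
  shows "rectifiable \<gamma>"
proof -
  have "contractible {0..1::real}" by (intro convex_imp_contractible convex_real_interval)
  then obtain \<phi> where \<phi>: "continuous_on {0..1} \<phi>" "\<And>t. t \<in> {0..1} \<Longrightarrow> \<gamma> t = \<kappa> (\<phi> t)"
    using simple_loop_lift[OF \<kappa> simple_loop_continuous_on[OF \<gamma>]] sub unfolding path_image_def by metis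
  have mono: "(strict_mono_on {0..1} \<phi> \<and> \<phi> 1 = \<phi> 0 + 1) \<or> (strict_antimono_on {0..1} \<phi> \<and> \<phi> 1 = \<phi> 0 - 1)"
    by (rule lift_of_simple_loop_monotone[OF \<gamma> \<kappa> \<phi>])
  define n where "n = \<lfloor>min (\<phi> 0) (\<phi> 1)\<rfloor>"
  have bdd: "bdd_above (inscribed_lengths \<kappa> (of_int k) (of_int k + 1))" for k
    using bdd_above_mono[OF _ inscribed_lengths_shift[OF \<kappa>]] rect by (simp add: rectifiable_def)
  have "bdd_above (inscribed_lengths \<kappa> (of_int n) (of_int n + 2))"
    using bdd_inscribed_lengths_combine[OF bdd[of n]] bdd[of "n + 1"] by (simp add: add.assoc)
  moreover have "mono_on {0..1} \<phi> \<or> antimono_on {0..1} \<phi>"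
    using mono unfolding monotone_on_def by (metis order_le_less)
  moreover have "\<phi> ` {0..1} \<subseteq> {of_int n..of_int n + 2}"
  proof
    fix y assume "y \<in> \<phi> ` {0..1}"
    then obtain t where t: "t \<in> {0..1}" "y = \<phi> t" by blast
    have "min (\<phi> 0) (\<phi> 1) \<le> y \<and> y \<le> min (\<phi> 0) (\<phi> 1) + 1"
    proof (cases "t = 0 \<or> t = 1")
      case True
      then show ?thesis using mono t by auto
    next
      case False
      then have "0 < t" "t < 1" using t by auto
      then have "strict_mono_on {0..1} \<phi> \<Longrightarrow> \<phi> 0 < \<phi> t \<and> \<phi> t < \<phi> 1"
         "strict_antimono_on {0..1} \<phi> \<Longrightarrow> \<phi> 1 < \<phi> t \<and> \<phi> t < \<phi> 0"
        by (auto simp: monotone_on_def)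
      then show ?thesis using mono t by auto
    qed
    then show "y \<in> {of_int n..of_int n + 2}" unfolding n_def by (auto simp: le_floor_iff) linarith+
  qed
  ultimately show ?thesis using rectifiable_reparametrized \<phi>(2) by blast
qed

section \<open>Monotonicity off a set of zero length\<close>

text \<open>
Suppose \<open>f b < f a\<close>. Since \<open>f ` E\<close> is null, some value \<open>y\<close> strictly between is not attained on \<open>E\<close>. At the
last time \<open>t\<close> at which \<open>f\<close> is at least \<open>y\<close> it equals \<open>y\<close> and stays below \<open>y\<close> afterwards, although \<open>t\<close> is
not in \<open>E\<close>. This replaces the usual argument by absolute continuity.
\<close>

lemma increasing_off_null_values:
  fixes f :: "real \<Rightarrow> real"
  assumes cont: "continuous_on {a..b} f" and "a \<le> b" and null: "negligible (f ` E)"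
    and inc: "\<And>t. t \<in> {a<..<b} - E \<Longrightarrow> eventually (\<lambda>s. f t < f s) (at_right t)"
  shows "f a \<le> f b"
proof (rule ccontr)
  assume "\<not> f a \<le> f b"
  then have "f b < f a" by simp
  then have "\<not> negligible {f b<..<f a}"
    using open_not_negligible[of "{f b<..<f a}"] by simp
  then have "\<not> {f b<..<f a} \<subseteq> f ` E" using null negligible_subset by blast
  then obtain y where y: "f b < y" "y < f a" "y \<notin> f ` E"
    by (meson greaterThanLessThan_iff subsetI)
  let ?A = "{t \<in> {a..b}. y \<le> f t}"
  have "closed ?A"
    using continuous_closed_preimage[OF cont closed_atLeastAtMost closed_atLeast[of y]]
    by (simp add: vimage_def Int_def)
  then have "compact ?A" using compact_Icc[of a b] by (metis (no_types, lifting) compact_Int_closed inf.absorb2 mem_Collect_eq subsetI)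
  moreover have "a \<in> ?A" using y \<open>a \<le> b\<close> by simp
  ultimately obtain t where t: "t \<in> ?A" "\<And>s. s \<in> ?A \<Longrightarrow> s \<le> t"
    using compact_attains_sup[of ?A] by blast
  have tb: "t < b" using t(1) y by (cases "t = b") auto
  have below: "f s < y" if "t < s" "s \<le> b" for s using t(2)[of s] t(1) that by force
  have "f t = y"
  proof (rule ccontr)
    assume "f t \<noteq> y"
    then have "y < f t" using t(1) by auto
    moreover have "continuous_on {t..b} f" by (rule continuous_on_subset[OF cont]) (use t in auto)
    ultimately obtain s where "t \<le> s" "s \<le> b" "f s = y" using IVT2'[of f b y t] y tb by auto
    then show False using below[of s] \<open>f t \<noteq> y\<close> by (cases "s = t") auto
  qed
  then have "t \<notin> E" "t \<noteq> a" using y by auto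
  then have "eventually (\<lambda>s. f t < f s) (at_right t)" using t(1) tb by (intro inc) auto
  moreover have "eventually (\<lambda>s. s \<in> {t<..<b}) (at_right t)" using eventually_at_right_real[OF tb] .
  ultimately have "eventually (\<lambda>s. False) (at_right t)"
    by eventually_elim (use below \<open>f t = y\<close> in force)
  then show False by simp
qed

text \<open>
The local Lipschitz bounds make \<open>f ` E\<close> null, so \<open>f\<close> is weakly increasing. If it were constant on an
interval, this interval would lie in \<open>E\<close> up to its end points and hence have zero length; but the
distance from \<open>\<sigma> a\<close> is 1-Lipschitz along \<open>\<sigma>\<close> and takes a whole interval of values there.
\<close>

lemma strict_mono_off_length_null:
  fixes f :: "real \<Rightarrow> real"
  assumes cont: "continuous_on {0..1} f" and \<sigma>: "simple_loop \<sigma>" and rect: "rectifiable \<sigma>"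
    and E: "E \<subseteq> {0..1}" "length_null \<sigma> E"
    and lip: "\<And>t. t \<in> {0..1} \<Longrightarrow> \<exists>\<epsilon>>0. \<exists>B. \<forall>r\<in>{0..1} \<inter> ball t \<epsilon>. \<forall>s\<in>{0..1} \<inter> ball t \<epsilon>.
       dist (f r) (f s) \<le> B * dist (\<sigma> r) (\<sigma> s)"
    and inc: "\<And>t. t \<in> {0<..<1} - E \<Longrightarrow> eventually (\<lambda>s. f t < f s) (at_right t)"
  shows "strict_mono_on {0..1} f"
proof -
  have null: "negligible (f ` E)"
  proof -
    have "\<exists>\<epsilon>>0. negligible (f ` (E \<inter> ball t \<epsilon>))" if t: "t \<in> {0..1}" for t
    proof -
      obtain \<epsilon> B where e: "\<epsilon> > 0" and B: "\<And>r s. r \<in> {0..1} \<inter> ball t \<epsilon> \<Longrightarrow> s \<in> {0..1} \<inter> ball t \<epsilon> \<Longrightarrow>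
           dist (f r) (f s) \<le> B * dist (\<sigma> r) (\<sigma> s)" using lip[OF t] by meson
      have "negligible (f ` (E \<inter> ball t \<epsilon>))"
      proof (rule length_null_lipschitz_image[OF rect])
        show "length_null \<sigma> (E \<inter> ball t \<epsilon>)"
          using E(2) unfolding length_null_def by (rule negligible_subset) blast
        fix r s assume rs: "r \<in> E \<inter> ball t \<epsilon>" "s \<in> E \<inter> ball t \<epsilon>"
        have "dist (f r) (f s) \<le> B * dist (\<sigma> r) (\<sigma> s)" using rs E(1) by (intro B) auto
        also have "\<dots> \<le> max B 0 * dist (\<sigma> r) (\<sigma> s)" by (intro mult_right_mono) auto
        finally show "dist (f r) (f s) \<le> max B 0 * dist (\<sigma> r) (\<sigma> s)" .
      qed (use E(1) in auto)
      then show ?thesis using e by blast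
    qed
    then obtain \<epsilon> where \<epsilon>: "\<And>t. t \<in> {0..1} \<Longrightarrow> \<epsilon> t > 0 \<and> negligible (f ` (E \<inter> ball t (\<epsilon> t)))" by metis
    have "{0..1} \<subseteq> (\<Union>t\<in>{0..1}. ball t (\<epsilon> t))" using \<epsilon> by force
    then obtain D where D: "D \<subseteq> {0..1}" "finite D" "{0..1} \<subseteq> (\<Union>t\<in>D. ball t (\<epsilon> t))"
      by (rule compactE_image[OF compact_Icc, rotated]) auto
    have "negligible (\<Union>t\<in>D. f ` (E \<inter> ball t (\<epsilon> t)))"
      by (rule negligible_Union) (use D \<epsilon> in auto)
    then show ?thesis by (rule negligible_subset) (use D(3) E(1) in blast)
  qed
  have mono: "f a \<le> f b" if "a \<le> b" "0 \<le> a" "b \<le> 1" for a b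
    using that inc null by (intro increasing_off_null_values[of a b f E] continuous_on_subset[OF cont]) auto
  show ?thesis
  proof (rule strict_mono_onI)
    fix a b :: real assume ab: "a \<in> {0..1}" "b \<in> {0..1}" "a < b"
    show "f a < f b"
    proof (rule ccontr)
      assume "\<not> f a < f b"
      then have const: "f s = f a" if "s \<in> {a..b}" for s
        using mono[of a s] mono[of s b] ab that by auto
      have sub: "{a<..<b} \<subseteq> E"
      proof (rule ccontr)
        assume "\<not> {a<..<b} \<subseteq> E"
        then obtain t where t: "t \<in> {a<..<b}" "t \<notin> E" by blast
        then have "eventually (\<lambda>s. f t < f s) (at_right t)" using ab by (intro inc) auto
        moreover have "eventually (\<lambda>s. s \<in> {t<..<b}) (at_right t)" using t by (intro eventually_at_right_real) auto
        ultimately have "eventually (\<lambda>s. False) (at_right t)"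
        proof eventually_elim
          case (elim s)
          then show ?case using const[of s] const[of t] t by auto
        qed
        then show False by simp
      qed
      define d where "d s = dist (\<sigma> a) (\<sigma> s)" for s
      define m where "m = (a + b) / 2"
      have m: "a < m" "m < b" using ab by (auto simp: m_def)
      have "\<sigma> a \<noteq> \<sigma> m"
      proof
        assume "\<sigma> a = \<sigma> m"
        then have "a - m \<in> \<int>" using simple_loop_eq_iff[OF \<sigma>] by blast
        then show False using Ints_nonzero_abs_ge1[of "a - m"] m ab by auto
      qed
      then have dm: "0 < d m" by (simp add: d_def)
      have contd: "continuous_on {a..m} d"
        unfolding d_def by (intro continuous_intros continuous_on_subset[OF simple_loop_continuous_on[OF \<sigma>]])
          (use ab m in auto)
      have "negligible (d ` E)"
      proof (rule length_null_lipschitz_image[OF rect E, of 1])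
        show "dist (d s) (d t) \<le> 1 * dist (\<sigma> s) (\<sigma> t)" for s t
          using abs_dist_diff_le[of "\<sigma> s" "\<sigma> a" "\<sigma> t"]  by (simp add: d_def dist_real_def dist_commute)
      qed simp
      moreover have "{0<..<d m} \<subseteq> d ` E"
      proof
        fix y assume y: "y \<in> {0<..<d m}"
        then obtain s where s: "a \<le> s" "s \<le> m" "d s = y"
          using IVT'[of d a y m] contd m by (auto simp: d_def)
        moreover have "s \<noteq> a" using s y by (auto simp: d_def)
        ultimately have "s \<in> E" using sub m by auto
        then show "y \<in> d ` E" using s(3) by blast
      qed
      ultimately have "negligible {0<..<d m}" by (rule negligible_subset)
      then show False using dm open_not_negligible[of "{0<..<d m}"] by simp
    qed
  qed
qed

section \<open>Tangents and feet along a regular curve\<close>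

lemma orthogonal_part_inner:
  fixes e u w :: "'a::real_inner"
  assumes "norm e = 1"
  shows "u \<bullet> w = (u \<bullet> e) * (w \<bullet> e) + (u - (u \<bullet> e) *\<^sub>R e) \<bullet> (w - (w \<bullet> e) *\<^sub>R e)"
    and "(norm (u - (u \<bullet> e) *\<^sub>R e))\<^sup>2 = (norm u)\<^sup>2 - (u \<bullet> e)\<^sup>2"
proof -
  have ee: "e \<bullet> e = 1" using assms by (simp add: norm_eq_1)
  show "u \<bullet> w = (u \<bullet> e) * (w \<bullet> e) + (u - (u \<bullet> e) *\<^sub>R e) \<bullet> (w - (w \<bullet> e) *\<^sub>R e)"
    by (simp add: inner_diff ee inner_commute algebra_simps)
  show "(norm (u - (u \<bullet> e) *\<^sub>R e))\<^sup>2 = (norm u)\<^sup>2 - (u \<bullet> e)\<^sup>2"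
    unfolding power2_norm_eq_inner
    by (simp add: inner_diff ee inner_commute algebra_simps power2_eq_square)
qed

text \<open>
If the lines spanned by \<open>u\<close> and \<open>w\<close> make an angle at most \<open>\<alpha>\<close> with the chord \<open>b\<close>, where
\<open>c = sin\<^sup>2 \<alpha>\<close>, then they make an angle at most \<open>2 \<alpha>\<close> with each other, and \<open>cos 2\<alpha> = 1 - 2 c\<close>.
\<close>

lemma unit_vectors_close_to_chord:
  fixes b u w :: "'a::real_inner"
  assumes "norm u = 1" "norm w = 1" "b \<noteq> 0"
    and "(norm b)\<^sup>2 - (b \<bullet> u)\<^sup>2 \<le> c * (norm b)\<^sup>2" "(norm b)\<^sup>2 - (b \<bullet> w)\<^sup>2 \<le> c * (norm b)\<^sup>2"
  shows "1 - 2 * c \<le> \<bar>u \<bullet> w\<bar>"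
proof (cases "c \<le> 1")
  case False
  then show ?thesis using abs_ge_zero[of "u \<bullet> w"] by linarith
next
  case True
  define e where "e = b /\<^sub>R norm b"
  have e: "norm e = 1" using assms(3) by (simp add: e_def)
  have part: "1 - c \<le> (v \<bullet> e)\<^sup>2" if "(norm b)\<^sup>2 - (b \<bullet> v)\<^sup>2 \<le> c * (norm b)\<^sup>2" for v
  proof -
    have "b \<bullet> v = norm b * (v \<bullet> e)" using assms(3) by (simp add: e_def inner_commute)
    then have "(norm b)\<^sup>2 * (1 - c) \<le> (norm b)\<^sup>2 * (v \<bullet> e)\<^sup>2"
      using that by (simp add: power_mult_distrib algebra_simps)
    then show ?thesis using assms(3) by simp
  qed
  note u = part[OF assms(4)] and w = part[OF assms(5)]
  define u' w' where "u' = u - (u \<bullet> e) *\<^sub>R e" and "w' = w - (w \<bullet> e) *\<^sub>R e"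
  have n: "norm u' \<le> sqrt c" "norm w' \<le> sqrt c"
    using orthogonal_part_inner(2)[OF e, of u] orthogonal_part_inner(2)[OF e, of w] u w assms(1,2)
    by (auto intro!: real_le_rsqrt simp: u'_def w'_def)
  have c0: "0 \<le> c" using n(1) norm_ge_zero[of u'] by (meson order_trans real_sqrt_ge_0_iff)
  have "\<bar>u' \<bullet> w'\<bar> \<le> norm u' * norm w'" by (rule Cauchy_Schwarz_ineq2)
  also have "\<dots> \<le> sqrt c * sqrt c" using n c0 by (intro mult_mono) auto
  finally have 1: "\<bar>u' \<bullet> w'\<bar> \<le> c" using c0 by simp
  have "sqrt (1 - c) \<le> \<bar>u \<bullet> e\<bar>" "sqrt (1 - c) \<le> \<bar>w \<bullet> e\<bar>"
    using u w real_sqrt_le_mono[of "1 - c"] by fastforce+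
  then have "sqrt (1 - c) * sqrt (1 - c) \<le> \<bar>u \<bullet> e\<bar> * \<bar>w \<bullet> e\<bar>"
    using True by (intro mult_mono) auto
  then have 2: "1 - c \<le> \<bar>(u \<bullet> e) * (w \<bullet> e)\<bar>" using True by (simp add: abs_mult)
  show ?thesis using 1 2 orthogonal_part_inner(1)[OF e, of u w] unfolding u'_def w'_def by linarith
qed

text \<open>
The triangle inequality for angles: \<open>u\<close> and \<open>v\<close> differ by at most \<open>\<pi>/2 - \<beta>\<close>, \<open>u\<close> and \<open>w\<close> by less
than \<open>\<beta>\<close>.
\<close>

lemma acute_if_angles_sum_below_right:
  fixes u v w :: "'a::real_inner"
  assumes "norm u = 1" "norm v = 1" "norm w = 1" and \<beta>: "0 < \<beta>" "\<beta> < pi / 2"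
    and "sin \<beta> \<le> u \<bullet> v" "cos \<beta> < u \<bullet> w"
  shows "0 < v \<bullet> w"
proof -
  have s: "0 < sin \<beta>" "0 < cos \<beta>" using \<beta> by (auto intro!: sin_gt_zero cos_gt_zero)
  define v' w' where "v' = v - (v \<bullet> u) *\<^sub>R u" and "w' = w - (w \<bullet> u) *\<^sub>R u"
  have "(sin \<beta>)\<^sup>2 \<le> (v \<bullet> u)\<^sup>2" "(cos \<beta>)\<^sup>2 \<le> (w \<bullet> u)\<^sup>2"
    using assms s by (auto intro!: power_mono simp: inner_commute)
  moreover have "(norm v')\<^sup>2 = 1 - (v \<bullet> u)\<^sup>2" "(norm w')\<^sup>2 = 1 - (w \<bullet> u)\<^sup>2"
    using orthogonal_part_inner(2)[OF assms(1)] assms(2,3) by (simp_all add: v'_def w'_def)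
  ultimately have "(norm v')\<^sup>2 \<le> (cos \<beta>)\<^sup>2" "(norm w')\<^sup>2 \<le> (sin \<beta>)\<^sup>2"
    using sin_cos_squared_add[of \<beta>] by linarith+
  then have n: "norm v' \<le> cos \<beta>" "norm w' \<le> sin \<beta>"
    using s by (auto intro: power2_le_imp_le)
  have "\<bar>v' \<bullet> w'\<bar> \<le> norm v' * norm w'" by (rule Cauchy_Schwarz_ineq2)
  also have "\<dots> \<le> cos \<beta> * sin \<beta>" using n s by (intro mult_mono) auto
  finally have 1: "\<bar>v' \<bullet> w'\<bar> \<le> cos \<beta> * sin \<beta>" .
  have "sin \<beta> * cos \<beta> < sin \<beta> * (u \<bullet> w)" using s assms by (intro mult_strict_left_mono) auto
  also have "\<dots> \<le> (u \<bullet> v) * (u \<bullet> w)" using s assms by (intro mult_right_mono) auto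
  finally show ?thesis
    using 1 orthogonal_part_inner(1)[OF assms(1), of v w] unfolding v'_def w'_def
    by (simp add: inner_commute mult.commute)
qed

text \<open>
A regular curve that runs in \<open>K\<close> and is tangent to the lines \<open>\<real> u p\<close>; in contrast to \<open>u\<close>, its unit
tangent \<open>T\<close> is continuous.
\<close>

locale thick_curve = thick_set K \<rho> u for K :: "'a::euclidean_space set" and \<rho> u +
  fixes \<kappa> \<kappa>' :: "real \<Rightarrow> 'a"
  assumes curve_in: "\<kappa> t \<in> K"
    and deriv: "(\<kappa> has_vector_derivative \<kappa>' t) (at t)"
    and deriv_cont: "continuous_on UNIV \<kappa>'"
    and deriv_nz: "\<kappa>' t \<noteq> 0"
    and tangent: "sgn (\<kappa>' t) = u (\<kappa> t) \<or> sgn (\<kappa>' t) = - u (\<kappa> t)"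
begin

abbreviation T :: "real \<Rightarrow> 'a" where "T t \<equiv> sgn (\<kappa>' t)"

lemma norm_T: "norm (T t) = 1" using deriv_nz by (simp add: norm_sgn)

lemma T_continuous: "continuous_on UNIV T"
  by (intro continuous_intros deriv_cont) (simp add: deriv_nz)

lemma curve_continuous: "continuous_on UNIV \<kappa>"
  using deriv by (meson continuous_at_imp_continuous_on has_vector_derivative_continuous)

lemma curvature_T: "q \<in> K \<Longrightarrow> (2 * \<rho>)\<^sup>2 * ((norm (q - \<kappa> t))\<^sup>2 - ((q - \<kappa> t) \<bullet> T t)\<^sup>2) \<le> norm (q - \<kappa> t) ^ 4"
  using curvature[OF curve_in, of q t] tangent[of t] by auto

lemma chord_T: "q \<in> K \<Longrightarrow>
  (norm (q - \<kappa> t))\<^sup>2 - ((q - \<kappa> t) \<bullet> T t)\<^sup>2 \<le> (norm (q - \<kappa> t))\<^sup>2 / (2 * \<rho>)\<^sup>2 * (norm (q - \<kappa> t))\<^sup>2"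
  using curvature_T[of q t] rho_pos by (simp add: field_simps power_mult_distrib flip: power_add)

lemma foot_T: "foot x = \<kappa> t \<Longrightarrow> (x - \<kappa> t) \<bullet> T t = 0"
  using foot_perp[of x] tangent[of t] by auto

text \<open>
By the tangent circle inequality at its two ends, a chord of length \<open>l\<close> makes an angle of at most
\<open>arcsin (l / (2 \<rho>))\<close> with both tangent lines. The signs of the tangents remain open, hence the absolute
value.
\<close>

lemma T_inner_ge: "1 - (norm (\<kappa> s - \<kappa> t))\<^sup>2 / (2 * \<rho>\<^sup>2) \<le> \<bar>T s \<bullet> T t\<bar>"
proof (cases "\<kappa> s = \<kappa> t")
  case True
  have "T s = T t \<or> T s = - T t" using tangent[of s] tangent[of t] True by auto
  then have "\<bar>T s \<bullet> T t\<bar> = 1" using norm_T[of t] by (auto simp: norm_eq_1)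
  then show ?thesis using True by simp
next
  case False
  let ?b = "\<kappa> s - \<kappa> t"
  have "1 - 2 * ((norm ?b)\<^sup>2 / (2 * \<rho>)\<^sup>2) \<le> \<bar>T s \<bullet> T t\<bar>"
  proof (rule unit_vectors_close_to_chord[OF norm_T norm_T, where b = ?b])
    show "?b \<noteq> 0" using False by simp
    show "(norm ?b)\<^sup>2 - (?b \<bullet> T t)\<^sup>2 \<le> (norm ?b)\<^sup>2 / (2 * \<rho>)\<^sup>2 * (norm ?b)\<^sup>2"
      by (rule chord_T[OF curve_in])
    have sq: "(?b \<bullet> v)\<^sup>2 = ((\<kappa> t - \<kappa> s) \<bullet> v)\<^sup>2" for v
      by (simp add: inner_diff_left power2_commute)
    show "(norm ?b)\<^sup>2 - (?b \<bullet> T s)\<^sup>2 \<le> (norm ?b)\<^sup>2 / (2 * \<rho>)\<^sup>2 * (norm ?b)\<^sup>2"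
      using chord_T[OF curve_in, of t s] unfolding sq by (simp add: norm_minus_commute)
  qed
  then show ?thesis by (simp add: power_mult_distrib)
qed

lemma local_chart:
  obtains \<epsilon> c where "\<epsilon> > 0" "c > 0"
    "\<And>x y. x \<in> ball x0 \<epsilon> \<Longrightarrow> y \<in> ball x0 \<epsilon> \<Longrightarrow>
       T x \<bullet> T y > 0 \<and> norm (\<kappa> y - \<kappa> x) \<le> \<rho> \<and> (y - x) * ((\<kappa> y - \<kappa> x) \<bullet> T x) \<ge> c * (y - x)\<^sup>2"
proof -
  define c where "c = norm (\<kappa>' x0) / 2"
  have c: "c > 0" using deriv_nz by (simp add: c_def)
  have cont: "isCont (\<lambda>z :: real \<times> real. \<kappa>' (fst z) \<bullet> T (snd z)) (x0, x0)"
    "isCont (\<lambda>z :: real \<times> real. T (fst z) \<bullet> T (snd z)) (x0, x0)"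
    "isCont (\<lambda>z :: real \<times> real. norm (\<kappa> (snd z) - \<kappa> (fst z))) (x0, x0)"
    by (intro continuous_on_interior[of UNIV] continuous_intros
        continuous_on_compose2[OF deriv_cont] continuous_on_compose2[OF T_continuous]
        continuous_on_compose2[OF curve_continuous]; simp)+
  have "\<kappa>' x0 \<bullet> T x0 = norm (\<kappa>' x0)"
    using deriv_nz[of x0] by (simp add: sgn_div_norm dot_square_norm power2_eq_square)
  then have "eventually (\<lambda>z. c < \<kappa>' (fst z) \<bullet> T (snd z)) (nhds (x0, x0))"
    using c cont(1) deriv_nz[of x0]
    by (intro order_tendstoD(1)[where y = "norm (\<kappa>' x0)"]) (auto simp: isCont_def tendsto_nhds_iff c_def)
  moreover have "T x0 \<bullet> T x0 = 1" using norm_T[of x0] by (simp add: norm_eq_1)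
  then have "eventually (\<lambda>z. 0 < T (fst z) \<bullet> T (snd z)) (nhds (x0, x0))"
    using cont(2)
    by (intro order_tendstoD(1)[where y = 1]) (auto simp: isCont_def tendsto_nhds_iff)
  moreover have "eventually (\<lambda>z. norm (\<kappa> (snd z) - \<kappa> (fst z)) < \<rho>) (nhds (x0, x0))"
    using cont(3) rho_pos
    by (intro order_tendstoD(2)[where y = 0]) (auto simp: isCont_def tendsto_nhds_iff)
  ultimately have "eventually (\<lambda>z. c < \<kappa>' (fst z) \<bullet> T (snd z) \<and> 0 < T (fst z) \<bullet> T (snd z) \<and>
      norm (\<kappa> (snd z) - \<kappa> (fst z)) < \<rho>) (nhds (x0, x0))" by eventually_elim auto
  then obtain e where e: "e > 0" and P: "\<And>z. dist z (x0, x0) < e \<Longrightarrow> c < \<kappa>' (fst z) \<bullet> T (snd z) \<and> 0 < T (fst z) \<bullet> T (snd z) \<and>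
      norm (\<kappa> (snd z) - \<kappa> (fst z)) < \<rho>" unfolding eventually_nhds_metric by blast
  have Q: "c < \<kappa>' x \<bullet> T y \<and> 0 < T x \<bullet> T y \<and> norm (\<kappa> y - \<kappa> x) < \<rho>" if "x \<in> ball x0 (e/2)" "y \<in> ball x0 (e/2)" for x y
  proof -
    have "dist (x, y) (x0, x0) \<le> dist x x0 + dist y x0"
      unfolding dist_Pair_Pair by (rule sqrt_sum_squares_le_sum) auto
    then have "dist (x, y) (x0, x0) < e" using that by (auto simp: dist_commute)
    then show ?thesis using P[of "(x, y)"] by simp
  qed
  show thesis
  proof (rule that[of "e / 2" c])
    fix x y assume xy: "x \<in> ball x0 (e/2)" "y \<in> ball x0 (e/2)"
    \<comment> \<open>mean value theorem for the height over the tangent line at \<open>x\<close>\<close>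
    have "c * (y - x)\<^sup>2 \<le> (y - x) * ((\<kappa> y - \<kappa> x) \<bullet> T x)"
    proof -
      let ?h = "\<lambda>z. \<kappa> z \<bullet> T x"
      have d: "(?h has_real_derivative \<kappa>' z \<bullet> T x) (at z)" for z
        using deriv[of z] unfolding has_real_derivative_iff_has_vector_derivative has_vector_derivative_def
        by (auto intro!: derivative_eq_intros)
      have *: "\<exists>z. a < z \<and> z < b \<and> ?h b - ?h a = (b - a) * (\<kappa>' z \<bullet> T x)" if "a < b" for a b
        by (rule MVT2[OF that d])
      have ball: "z \<in> ball x0 (e/2)" if "a < z" "z < b" "a \<in> ball x0 (e/2)" "b \<in> ball x0 (e/2)" for a b z
        using that unfolding mem_ball dist_real_def by linarith
      have "\<exists>z\<in>ball x0 (e/2). (y - x) * ((\<kappa> y - \<kappa> x) \<bullet> T x) = (y - x)\<^sup>2 * (\<kappa>' z \<bullet> T x)"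
      proof (cases x y rule: linorder_cases)
        case less
        from *[OF this] obtain z where z: "x < z" "z < y" "?h y - ?h x = (y - x) * (\<kappa>' z \<bullet> T x)" by blast
        then show ?thesis using ball[OF z(1,2) xy]
          by (intro bexI[of _ z]) (simp_all add: inner_diff_left power2_eq_square)
      next
        case greater
        from *[OF this] obtain z where z: "y < z" "z < x" "?h x - ?h y = (x - y) * (\<kappa>' z \<bullet> T x)" by blast
        then have "(\<kappa> y - \<kappa> x) \<bullet> T x = (y - x) * (\<kappa>' z \<bullet> T x)"
          by (simp add: inner_diff_left algebra_simps)
        then show ?thesis using ball[OF z(1,2) xy(2,1)]
          by (intro bexI[of _ z]) (simp_all add: power2_eq_square)
      qed (use xy in auto)
      then obtain z where z: "z \<in> ball x0 (e/2)" "(y - x) * ((\<kappa> y - \<kappa> x) \<bullet> T x) = (y - x)\<^sup>2 * (\<kappa>' z \<bullet> T x)" by blast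
      have "(y - x)\<^sup>2 * c \<le> (y - x)\<^sup>2 * (\<kappa>' z \<bullet> T x)" using Q[OF z(1) xy(1)] by (intro mult_left_mono) auto
      then show ?thesis using z(2) by (simp add: mult.commute)
    qed
    then show "T x \<bullet> T y > 0 \<and> norm (\<kappa> y - \<kappa> x) \<le> \<rho> \<and> (y - x) * ((\<kappa> y - \<kappa> x) \<bullet> T x) \<ge> c * (y - x)\<^sup>2"
      using Q[OF xy] by auto
  qed (use e c in auto)
qed

text \<open>
Passing from \<open>X\<close> to \<open>Y\<close>, the parameter of the foot grows with the component of \<open>Y - X\<close> along the
tangent. Indeed, with \<open>b = \<kappa> y - \<kappa> x\<close>, the component of \<open>Y - X\<close> along \<open>T x\<close> differs from \<open>m = b \<bullet> T x\<close> by
\<open>(Y - \<kappa> y) \<bullet> (T x - T y)\<close>, as \<open>X - \<kappa> x\<close> and \<open>Y - \<kappa> y\<close> are normal to the curve. This error is at most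
\<open>(\<rho>/2) (|b|/\<rho>) = |b|/2\<close>, whereas \<open>|m| \<ge> 4/5 |b|\<close>; so at least \<open>3/8\<close> of \<open>m\<close> survives.
The product with \<open>y - x\<close> treats both orders of \<open>x\<close> and \<open>y\<close> at once.
\<close>

lemma foot_chart_estimate:
  assumes X: "foot X = \<kappa> x" and Y: "foot Y = \<kappa> y" "dist Y (foot Y) \<le> \<delta>" and "2 * \<delta> \<le> \<rho>"
    and TT: "T x \<bullet> T y > 0" and small: "norm (\<kappa> y - \<kappa> x) \<le> \<rho>" and c: "c \<ge> 0"
    and chart: "(y - x) * ((\<kappa> y - \<kappa> x) \<bullet> T x) \<ge> c * (y - x)\<^sup>2"
  shows "(y - x) * ((Y - X) \<bullet> T x) \<ge> 3 / 8 * c * (y - x)\<^sup>2"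
proof -
  define b where "b = \<kappa> y - \<kappa> x"
  define m where "m = b \<bullet> T x"
  have m: "4 / 5 * norm b \<le> \<bar>m\<bar>"
  proof -
    have "(norm b)\<^sup>2 \<le> \<rho>\<^sup>2" using small by (intro power_mono) (simp_all add: b_def)
    then have "(norm b)\<^sup>2 / (2 * \<rho>)\<^sup>2 \<le> 1 / 4" using rho_pos by (simp add: power_mult_distrib field_simps)
    then have "(norm b)\<^sup>2 / (2 * \<rho>)\<^sup>2 * (norm b)\<^sup>2 \<le> 1 / 4 * (norm b)\<^sup>2" by (intro mult_right_mono) auto
    then have "3 / 4 * (norm b)\<^sup>2 \<le> m\<^sup>2" using chord_T[OF curve_in, of y x] by (simp add: b_def m_def)
    moreover have "(4 / 5 * norm b)\<^sup>2 \<le> 3 / 4 * (norm b)\<^sup>2" by (simp add: power_mult_distrib power2_eq_square)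
    ultimately have "(4 / 5 * norm b)\<^sup>2 \<le> \<bar>m\<bar>\<^sup>2" by simp
    then show ?thesis by (rule power2_le_imp_le) simp
  qed
  have TT': "norm (T x - T y) \<le> norm b / \<rho>"
  proof -
    have "(norm (T x - T y))\<^sup>2 = 2 - 2 * (T x \<bullet> T y)"
      using norm_T[of x] norm_T[of y] unfolding power2_norm_eq_inner norm_eq_1
      by (simp add: inner_diff inner_commute)
    also have "\<dots> \<le> 2 * ((norm b)\<^sup>2 / (2 * \<rho>\<^sup>2))"
      using T_inner_ge[of x y] TT by (simp add: b_def norm_minus_commute)
    also have "\<dots> = (norm b / \<rho>)\<^sup>2" by (simp add: power_divide)
    finally show ?thesis using rho_pos by (auto intro: power2_le_imp_le)
  qed
  have "(Y - X) \<bullet> T x = (Y - \<kappa> y) \<bullet> (T x - T y) + m"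
  proof -
    have "(Y - X) \<bullet> T x = (Y - \<kappa> y) \<bullet> T x + (b \<bullet> T x - (X - \<kappa> x) \<bullet> T x)"
      by (simp add: b_def inner_diff_left)
    also have "\<dots> = (Y - \<kappa> y) \<bullet> (T x - T y) + m"
      using foot_T[OF X] foot_T[OF Y(1)] by (simp add: m_def inner_diff_right)
    finally show ?thesis .
  qed
  moreover have "\<bar>(Y - \<kappa> y) \<bullet> (T x - T y)\<bar> \<le> norm b / 2"
  proof -
    have "\<bar>(Y - \<kappa> y) \<bullet> (T x - T y)\<bar> \<le> norm (Y - \<kappa> y) * norm (T x - T y)" by (rule Cauchy_Schwarz_ineq2)
    also have "\<dots> \<le> (\<rho> / 2) * (norm b / \<rho>)"
      using TT' Y \<open>2 * \<delta> \<le> \<rho>\<close> rho_pos by (intro mult_mono) (auto simp: dist_norm)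
    finally show ?thesis using rho_pos by simp
  qed
  ultimately have "\<bar>(Y - X) \<bullet> T x - m\<bar> \<le> 5 / 8 * \<bar>m\<bar>" using m by linarith
  then have "\<bar>y - x\<bar> * \<bar>(Y - X) \<bullet> T x - m\<bar> \<le> \<bar>y - x\<bar> * (5 / 8 * \<bar>m\<bar>)" by (intro mult_left_mono) auto
  moreover have "\<bar>y - x\<bar> * \<bar>m\<bar> = (y - x) * m"
  proof -
    have "0 \<le> c * (y - x)\<^sup>2" using c by simp
    then have "0 \<le> (y - x) * m" using chart by (simp add: m_def b_def)
    then show ?thesis by (simp flip: abs_mult)
  qed
  moreover have "- ((y - x) * ((Y - X) \<bullet> T x - m)) \<le> \<bar>y - x\<bar> * \<bar>(Y - X) \<bullet> T x - m\<bar>"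
    unfolding abs_mult[symmetric] by (rule abs_ge_minus_self)
  ultimately have "3 / 8 * ((y - x) * m) \<le> (y - x) * ((Y - X) \<bullet> T x)" by (simp add: right_diff_distrib)
  moreover have "3 / 8 * (c * (y - x)\<^sup>2) \<le> 3 / 8 * ((y - x) * m)" using chart by (simp add: m_def b_def)
  ultimately show ?thesis by simp
qed

end

section \<open>Transversality\<close>

lemma has_unit_tangent_norm:
  assumes "simple_loop \<sigma>" "has_unit_tangent \<sigma> v t"
  shows "norm v = 1"
proof -
  have "((\<lambda>s. norm (sgn (s - t) *\<^sub>R sgn (\<sigma> s - \<sigma> t))) \<longlongrightarrow> norm v) (at t)"
    using assms(2) unfolding has_unit_tangent_def by (rule tendsto_norm)
  moreover have "\<forall>\<^sub>F s in at t. norm (sgn (s - t) *\<^sub>R sgn (\<sigma> s - \<sigma> t)) = 1"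
    unfolding eventually_at
  proof (intro exI[of _ 1] conjI ballI impI)
    fix s assume s: "s \<noteq> t \<and> dist s t < 1"
    then have "s - t \<notin> \<int>" using Ints_nonzero_abs_ge1[of "s - t"] by (auto simp: dist_real_def)
    then have "\<sigma> s \<noteq> \<sigma> t" using simple_loop_eq_iff[OF assms(1)] by blast
    then show "norm (sgn (s - t) *\<^sub>R sgn (\<sigma> s - \<sigma> t)) = 1" using s by (simp add: norm_sgn sgn_if)
  qed simp
  ultimately have "((\<lambda>s. 1) \<longlongrightarrow> norm v) (at t)" by (rule Lim_transform_eventually)
  then show ?thesis by (simp add: tendsto_const_iff)
qed

lemma has_unit_tangent_unique:
  "has_unit_tangent \<sigma> v t \<Longrightarrow> has_unit_tangent \<sigma> w t \<Longrightarrow> v = w"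
  unfolding has_unit_tangent_def by (rule tendsto_unique[rotated]) auto

lemma has_unit_tangent_reparametrized:
  assumes \<kappa>: "has_unit_tangent \<kappa> w (\<phi> t)" and cont: "continuous_on {0..1} \<phi>"
    and mono: "strict_mono_on {0..1} \<phi>" and t: "t \<in> {0<..<1}"
    and eq: "\<And>s. s \<in> {0..1} \<Longrightarrow> \<gamma> s = \<kappa> (\<phi> s)"
  shows "has_unit_tangent \<gamma> w t"
proof -
  have nbh: "\<forall>\<^sub>F s in at t. s \<in> {0<..<1} \<and> s \<noteq> t"
    using eventually_at_in_open[of "{0<..<1}" t] t by simp
  have ne: "\<phi> s \<noteq> \<phi> t" if "s \<in> {0<..<1}" "s \<noteq> t" for s
    using strict_mono_on_eqD[OF mono, of s t] that t by auto
  have "isCont \<phi> t" using cont t by (intro continuous_on_interior[of "{0..1}"]) auto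
  then have "(\<phi> \<longlongrightarrow> \<phi> t) (at t)" by (simp add: isCont_def)
  moreover have "\<forall>\<^sub>F s in at t. \<phi> s \<noteq> \<phi> t" using nbh by eventually_elim (use ne in auto)
  ultimately have "filterlim \<phi> (at (\<phi> t)) (at t)" by (simp add: filterlim_at)
  then have "((\<lambda>s. sgn (\<phi> s - \<phi> t) *\<^sub>R sgn (\<kappa> (\<phi> s) - \<kappa> (\<phi> t))) \<longlongrightarrow> w) (at t)"
    using \<kappa> unfolding has_unit_tangent_def by (rule filterlim_compose[rotated])
  moreover have "\<forall>\<^sub>F s in at t. sgn (\<phi> s - \<phi> t) *\<^sub>R sgn (\<kappa> (\<phi> s) - \<kappa> (\<phi> t)) = sgn (s - t) *\<^sub>R sgn (\<gamma> s - \<gamma> t)"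
    using nbh
  proof eventually_elim
    case (elim s)
    then have "sgn (\<phi> s - \<phi> t) = sgn (s - t)"
      using strict_mono_onD[OF mono, of s t] strict_mono_onD[OF mono, of t s] t
      by (cases "s < t") (auto simp: sgn_if)
    then show ?case using eq[of s] eq[of t] elim t by simp
  qed
  ultimately show ?thesis unfolding has_unit_tangent_def by (rule Lim_transform_eventually)
qed

text \<open>
The triangle inequality alone gives \<open>dist (foot X) p \<le> 2 \<delta>\<close>. Being strictly better is what makes the
crossings in \<open>transversality\<close> strict.
\<close>

lemma (in thick_set) foot_drift:
  assumes "p \<in> K" "dist X p \<le> \<delta>" "0 < \<delta>" "2 * \<delta> < \<rho>"
  shows "(dist (foot X) p)\<^sup>2 < 2 * \<delta>\<^sup>2"
proof -
  have "dist X (foot X) \<le> \<delta>" using foot_le[OF assms(1), of X] assms by linarith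
  then have half: "1 / 2 < 1 - dist X (foot X) / \<rho>" using assms rho_pos by (auto simp: field_simps)
  have le: "(dist (foot X) p)\<^sup>2 * (1 - dist X (foot X) / \<rho>) \<le> \<delta>\<^sup>2"
  proof -
    have "(dist X p)\<^sup>2 \<le> \<delta>\<^sup>2" using assms by (intro power_mono) auto
    then show ?thesis using foot_dist_sq[OF foot_in assms(1) foot_perp, of X] zero_le_power2[of "dist X (foot X)"] by linarith
  qed
  show ?thesis
  proof (rule ccontr)
    assume "\<not> ?thesis"
    then have "2 * \<delta>\<^sup>2 * (1 / 2) < (dist (foot X) p)\<^sup>2 * (1 - dist X (foot X) / \<rho>)"
      using half assms(3) by (intro mult_le_less_imp_less) auto
    then show False using le by simp
  qed
qed

context thick_curve
begin

text \<open>
By \<open>T_inner_ge\<close>, the tangents at \<open>f s\<close> and \<open>f 0\<close> are never orthogonal, so their inner product, which is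
\<open>1\<close> at \<open>s = 0\<close>, keeps its sign.
\<close>

lemma tangent_sign_persists:
  assumes f: "continuous_on {0..1} f" and near: "\<And>s. s \<in> {0..1} \<Longrightarrow> (norm (\<kappa> (f s) - \<kappa> (f 0)))\<^sup>2 < 2 * \<rho>\<^sup>2"
  shows "0 < T (f 0) \<bullet> T (f (1::real))"
proof (rule ccontr)
  let ?g = "\<lambda>s. T (f s) \<bullet> T (f 0)"
  assume "\<not> ?thesis"
  then have "?g 1 \<le> 0" by (simp add: inner_commute)
  moreover have "?g 0 = 1" using norm_T[of "f 0"] by (simp add: norm_eq_1)
  moreover have "continuous_on {0..1} ?g"
    by (intro continuous_intros continuous_on_compose2[OF T_continuous f]) auto
  ultimately obtain s where s: "s \<in> {0..1}" "?g s = 0"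
    using IVT2'[of ?g 1 0 0] by auto
  have "(norm (\<kappa> (f s) - \<kappa> (f 0)))\<^sup>2 / (2 * \<rho>\<^sup>2) < 1"
    using near[OF s(1)] rho_pos by simp
  then show False using T_inner_ge[of "f s" "f 0"] s(2) by simp
qed

text \<open>
Let \<open>A = arcsin (\<delta> / \<rho>)\<close>. The tangents at \<open>a\<close> and at \<open>b\<close> differ by an angle less than \<open>2 A\<close>, and \<open>v\<close> differs
from the tangent at \<open>a\<close> by at most \<open>\<pi>/2 - 2 A\<close>; thus \<open>v\<close> crosses the normal disk at \<open>b\<close> in the positive
direction.
\<close>

lemma transversality:
  assumes d: "0 < \<delta>" "2 * \<delta> < \<rho>" and X: "foot X = \<kappa> b" "dist X (\<kappa> a) \<le> \<delta>"
    and TT: "0 < T a \<bullet> T b" and v: "norm v = 1" "sin (2 * arcsin (\<delta> / \<rho>)) \<le> T a \<bullet> v"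
  shows "0 < v \<bullet> T b"
proof -
  define A where "A = arcsin (\<delta> / \<rho>)"
  have q: "0 < \<delta> / \<rho>" "\<delta> / \<rho> < 1 / 2" using d by (auto simp: field_simps)
  have sA: "sin A = \<delta> / \<rho>" unfolding A_def by (rule sin_arcsin) (use q in linarith)+
  have "arcsin 0 < A" unfolding A_def by (rule arcsin_less_arcsin) (use q in linarith)+
  then have A0: "0 < A" by simp
  have "A < arcsin (1 / 2)" unfolding A_def by (rule arcsin_less_arcsin) (use q in linarith)+
  then have A1: "A < pi / 6" using arcsin_sin[of "pi / 6"] pi_gt_zero by (simp add: sin_30)
  have "(norm (\<kappa> a - \<kappa> b))\<^sup>2 < 2 * \<delta>\<^sup>2"
    using foot_drift[OF curve_in X(2) d] X(1) by (simp add: dist_norm norm_minus_commute)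
  then have "(norm (\<kappa> a - \<kappa> b))\<^sup>2 / (2 * \<rho>\<^sup>2) < 2 * \<delta>\<^sup>2 / (2 * \<rho>\<^sup>2)"
    using rho_pos by (intro divide_strict_right_mono) auto
  also have "\<dots> = (sin A)\<^sup>2" by (simp add: sA power_divide)
  finally have "1 - (sin A)\<^sup>2 < T a \<bullet> T b" using T_inner_ge[of a b] TT by linarith
  moreover have "cos (2 * A) \<le> 1 - (sin A)\<^sup>2" by (simp add: cos_double_sin)
  ultimately have "cos (2 * A) < T a \<bullet> T b" by linarith
  then show ?thesis
    using A0 A1 pi_gt_zero v by (intro acute_if_angles_sum_below_right[OF norm_T v(1) norm_T, of "2 * A" a b]) (auto simp: A_def)
qed

end

locale thick_loop = thick_curve K \<rho> u \<kappa> \<kappa>' for K :: "(real^3) set" and \<rho> u \<kappa> \<kappa>' +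
  assumes loop: "simple_loop \<kappa>"
begin

lemma reversed: "thick_loop K \<rho> u (\<lambda>t. \<kappa> (- t)) (\<lambda>t. - \<kappa>' (- t))"
proof unfold_locales
  fix t
  show "\<kappa> (- t) \<in> K" by (rule curve_in)
  have "((\<lambda>t. - t) has_real_derivative - 1) (at t)" by (auto intro!: derivative_eq_intros)
  then show "((\<lambda>t. \<kappa> (- t)) has_vector_derivative - \<kappa>' (- t)) (at t)"
    using vector_diff_chain_at[of uminus "-1" t \<kappa> "\<kappa>' (- t)"] deriv[of "- t"]
    by (simp add: o_def has_real_derivative_iff_has_vector_derivative)
  show "continuous_on UNIV (\<lambda>t. - \<kappa>' (- t))"
    by (intro continuous_intros continuous_on_compose2[OF deriv_cont]) auto
  show "- \<kappa>' (- t) \<noteq> 0" using deriv_nz by simp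
  show "sgn (- \<kappa>' (- t)) = u (\<kappa> (- t)) \<or> sgn (- \<kappa>' (- t)) = - u (\<kappa> (- t))"
    using tangent[of "- t"] by (auto simp: sgn_minus)
  show "simple_loop (\<lambda>t. \<kappa> (- t))" by (rule simple_loop_reverse[OF loop])
qed

text \<open>
The foot of \<open>\<sigma>\<close> advances along \<open>K\<close> at every parameter at which \<open>\<sigma>\<close> has a transversal tangent, and the
remaining parameters are negligible.
\<close>

lemma foot_lift_strict_mono:
  assumes \<sigma>: "simple_loop \<sigma>" "rectifiable \<sigma>" and f: "continuous_on {0..1} f"
    and foot: "\<And>t. t \<in> {0..1} \<Longrightarrow> foot (\<sigma> t) = \<kappa> (f t) \<and> dist (\<sigma> t) (foot (\<sigma> t)) \<le> \<delta>" and d: "2 * \<delta> < \<rho>"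
    and E: "E \<subseteq> {0..1}" "length_null \<sigma> E"
    and tan: "\<And>t. t \<in> {0<..<1} - E \<Longrightarrow> \<exists>v. has_unit_tangent \<sigma> v t \<and> 0 < v \<bullet> T (f t)"
  shows "strict_mono_on {0..1} f"
proof -
  \<comment> \<open>Near each parameter the estimate holds with a uniform constant; by Cauchy-Schwarz it makes \<open>f\<close>
     Lipschitz with respect to \<open>\<sigma>\<close> there, and its sign makes \<open>f\<close> increase where \<open>\<sigma>\<close> is transversal.\<close>
  have local: "\<exists>\<epsilon>>0. \<exists>c>0. \<forall>r\<in>{0..1} \<inter> ball t \<epsilon>. \<forall>s\<in>{0..1} \<inter> ball t \<epsilon>.
     c * (f s - f r)\<^sup>2 \<le> (f s - f r) * ((\<sigma> s - \<sigma> r) \<bullet> T (f r))" if t: "t \<in> {0..1}" for t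
  proof -
    obtain e c where e: "e > 0" "c > 0" and chart:
      "\<And>x y. x \<in> ball (f t) e \<Longrightarrow> y \<in> ball (f t) e \<Longrightarrow>
       T x \<bullet> T y > 0 \<and> norm (\<kappa> y - \<kappa> x) \<le> \<rho> \<and> (y - x) * ((\<kappa> y - \<kappa> x) \<bullet> T x) \<ge> c * (y - x)\<^sup>2"
      by (rule local_chart[of "f t"]) blast
    obtain \<epsilon> where \<epsilon>: "\<epsilon> > 0" "\<And>s. s \<in> {0..1} \<Longrightarrow> dist s t < \<epsilon> \<Longrightarrow> dist (f s) (f t) < e"
      using f t e(1) unfolding continuous_on_iff by blast
    have est: "\<forall>r\<in>{0..1} \<inter> ball t \<epsilon>. \<forall>s\<in>{0..1} \<inter> ball t \<epsilon>.
        3 / 8 * c * (f s - f r)\<^sup>2 \<le> (f s - f r) * ((\<sigma> s - \<sigma> r) \<bullet> T (f r))"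
    proof (intro ballI)
      fix r s assume rs: "r \<in> {0..1} \<inter> ball t \<epsilon>" "s \<in> {0..1} \<inter> ball t \<epsilon>"
      then have "f r \<in> ball (f t) e" "f s \<in> ball (f t) e" using \<epsilon>(2) by (auto simp: dist_commute)
      then show "3 / 8 * c * (f s - f r)\<^sup>2 \<le> (f s - f r) * ((\<sigma> s - \<sigma> r) \<bullet> T (f r))"
        using chart[of "f r" "f s"] foot[of r] foot[of s] rs d e(2)
        by (intro foot_chart_estimate) auto
    qed
    have "0 < 3 / 8 * c" using e by simp
    with est \<epsilon>(1) show ?thesis by blast
  qed
  show ?thesis
  proof (rule strict_mono_off_length_null[OF f \<sigma> E])
    fix t :: real assume t: "t \<in> {0..1}"
    obtain \<epsilon> c where \<epsilon>: "\<epsilon> > 0" "c > 0" and est: "\<And>r s. r \<in> {0..1} \<inter> ball t \<epsilon> \<Longrightarrow> s \<in> {0..1} \<inter> ball t \<epsilon> \<Longrightarrow>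
     c * (f s - f r)\<^sup>2 \<le> (f s - f r) * ((\<sigma> s - \<sigma> r) \<bullet> T (f r))" using local[OF t] by meson
    have "dist (f r) (f s) \<le> 1 / c * dist (\<sigma> r) (\<sigma> s)" if "r \<in> {0..1} \<inter> ball t \<epsilon>" "s \<in> {0..1} \<inter> ball t \<epsilon>" for r s
    proof -
      have "c * \<bar>f s - f r\<bar> * \<bar>f s - f r\<bar> \<le> (f s - f r) * ((\<sigma> s - \<sigma> r) \<bullet> T (f r))"
        using est[OF that] by (simp add: power2_eq_square mult.assoc)
      also have "\<dots> \<le> \<bar>f s - f r\<bar> * \<bar>(\<sigma> s - \<sigma> r) \<bullet> T (f r)\<bar>" unfolding abs_mult[symmetric] by (rule abs_ge_self)
      also have "\<dots> \<le> \<bar>f s - f r\<bar> * norm (\<sigma> s - \<sigma> r)"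
        using Cauchy_Schwarz_ineq2[of "\<sigma> s - \<sigma> r" "T (f r)"] norm_T by (intro mult_left_mono) auto
      finally have "c * \<bar>f s - f r\<bar> * \<bar>f s - f r\<bar> \<le> norm (\<sigma> s - \<sigma> r) * \<bar>f s - f r\<bar>" by (simp add: mult.commute)
      then have "c * \<bar>f s - f r\<bar> \<le> norm (\<sigma> s - \<sigma> r)"
        by (cases "f s = f r") (auto simp: mult_le_cancel_right)
      then show ?thesis using \<epsilon>(2) by (simp add: dist_norm field_simps norm_minus_commute abs_minus_commute)
    qed
    then show "\<exists>\<epsilon>>0. \<exists>B. \<forall>r\<in>{0..1} \<inter> ball t \<epsilon>. \<forall>s\<in>{0..1} \<inter> ball t \<epsilon>. dist (f r) (f s) \<le> B * dist (\<sigma> r) (\<sigma> s)"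
      using \<epsilon>(1) by blast
  next
    fix t :: real assume t: "t \<in> {0<..<1} - E"
    then obtain v where v: "has_unit_tangent \<sigma> v t" "0 < v \<bullet> T (f t)" using tan by blast
    have "t \<in> {0..1}" using t by auto
    from local[OF this] obtain \<epsilon> c where \<epsilon>: "\<epsilon> > 0" "c > 0" and est: "\<And>r s. r \<in> {0..1} \<inter> ball t \<epsilon> \<Longrightarrow> s \<in> {0..1} \<inter> ball t \<epsilon> \<Longrightarrow>
     c * (f s - f r)\<^sup>2 \<le> (f s - f r) * ((\<sigma> s - \<sigma> r) \<bullet> T (f r))" by meson
    have "((\<lambda>s. (sgn (s - t) *\<^sub>R sgn (\<sigma> s - \<sigma> t)) \<bullet> T (f t)) \<longlongrightarrow> v \<bullet> T (f t)) (at t)"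
      using v(1) unfolding has_unit_tangent_def by (intro tendsto_intros)
    then have "\<forall>\<^sub>F s in at t. 0 < (sgn (s - t) *\<^sub>R sgn (\<sigma> s - \<sigma> t)) \<bullet> T (f t)"
      using v(2) by (rule order_tendstoD(1))
    then have "\<forall>\<^sub>F s in at_right t. 0 < (sgn (s - t) *\<^sub>R sgn (\<sigma> s - \<sigma> t)) \<bullet> T (f t)"
      by (simp add: eventually_at_split)
    moreover have "\<forall>\<^sub>F s in at_right t. s \<in> {t<..<min 1 (t + \<epsilon>)}"
      using t \<epsilon> by (intro eventually_at_right_real) auto
    ultimately show "\<forall>\<^sub>F s in at_right t. f t < f s"
    proof eventually_elim
      case (elim s)
      then have "0 < sgn (\<sigma> s - \<sigma> t) \<bullet> T (f t)" by simp
      then have pos: "0 < (\<sigma> s - \<sigma> t) \<bullet> T (f t)"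
        by (auto simp: sgn_div_norm zero_less_mult_iff zero_less_divide_iff)
      have st: "s \<in> {0..1} \<inter> ball t \<epsilon>" "t \<in> {0..1} \<inter> ball t \<epsilon>"
        using elim t \<epsilon> by (auto simp: dist_real_def)
      show ?case
      proof (cases "f s" "f t" rule: linorder_cases)
        case less
        then have "(f s - f t) * ((\<sigma> s - \<sigma> t) \<bullet> T (f t)) < 0" using pos by (intro mult_neg_pos) auto
        moreover have "0 \<le> c * (f s - f t)\<^sup>2" using \<epsilon> by simp
        ultimately show ?thesis using est[OF st(2,1)] by linarith
      next
        case equal
        have "foot (\<sigma> s) = \<kappa> (f t)" "foot (\<sigma> t) = \<kappa> (f t)" using foot[of s] foot[of t] st equal by auto
        then have "(\<sigma> s - \<kappa> (f t)) \<bullet> T (f t) = 0" "(\<sigma> t - \<kappa> (f t)) \<bullet> T (f t) = 0" by (auto intro: foot_T)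
        then have "(\<sigma> s - \<sigma> t) \<bullet> T (f t) = 0" by (simp add: inner_diff_left)
        then show ?thesis using pos by simp
      qed simp
    qed
  qed
qed

end

section \<open>The projection of a nearby loop\<close>

lemma connected_in_one_component:
  assumes K: "link_param n \<gamma> K" and C: "connected C" "C \<subseteq> K" and i: "i < n" "C \<inter> path_image (\<gamma> i) \<noteq> {}"
  shows "C \<subseteq> path_image (\<gamma> i)"
proof -
  let ?B = "\<Union>j\<in>{..<n} - {i}. path_image (\<gamma> j)"
  have closed: "closed (path_image (\<gamma> j))" if "j < n" for j
    using K that unfolding link_param_def simple_loop_def
    by (blast intro: closed_simple_path_image)
  have "closed ?B" by (intro closed_UN) (auto simp: closed)
  moreover have "C \<subseteq> path_image (\<gamma> i) \<union> ?B" using K C(2) unfolding link_param_def by blast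
  moreover have "path_image (\<gamma> i) \<inter> ?B = {}"
    using K i(1) unfolding link_param_def disjoint_family_on_def by blast
  ultimately have "path_image (\<gamma> i) \<inter> C = {} \<or> ?B \<inter> C = {}"
    using connected_closedD[OF C(1), of "path_image (\<gamma> i)" ?B] closed[OF i(1)] by blast
  then show ?thesis using i(2) \<open>C \<subseteq> path_image (\<gamma> i) \<union> ?B\<close> by blast
qed

lemma component_within_component:
  assumes K: "link_param n \<gamma> K" and C: "connected C" "C \<subseteq> K" "C \<noteq> {}"
  obtains j where "j < n" "C \<subseteq> path_image (\<gamma> j)"
proof -
  obtain p where p: "p \<in> C" using C(3) by blast
  then obtain j where "j < n" "p \<in> path_image (\<gamma> j)" using K C(2) unfolding link_param_def by blast
  then show thesis using connected_in_one_component[OF K C(1,2)] p that by blast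
qed

lemma link_compact: "link_param n \<gamma> K \<Longrightarrow> compact K"
  unfolding link_param_def simple_loop_def
  by (auto intro!: compact_UN compact_simple_path_image)

lemma unit_period_image:
  assumes "simple_loop \<kappa>" and f: "continuous_on {0..1} f" and "f (1::real) = f 0 + (1::real)"
  shows "(\<lambda>t. \<kappa> (f t)) ` {0..1} = path_image \<kappa>"
proof
  show "(\<lambda>t. \<kappa> (f t)) ` {0..1} \<subseteq> path_image \<kappa>" using simple_loop_range[OF assms(1)] by blast
  show "path_image \<kappa> \<subseteq> (\<lambda>t. \<kappa> (f t)) ` {0..1}"
  proof
    fix p assume "p \<in> path_image \<kappa>"
    then obtain x where x: "p = \<kappa> x" by (auto simp: path_image_def)
    define y where "y = x - of_int \<lfloor>x - f 0\<rfloor>"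
    have "f 0 \<le> y" "y \<le> f 1" unfolding y_def assms(3) by linarith+
    then obtain t where t: "t \<in> {0..1}" "f t = y" using IVT'[of f 0 y 1] f by auto
    have "\<kappa> y = \<kappa> x" using simple_loop_shift[OF assms(1), of x "- \<lfloor>x - f 0\<rfloor>"] by (simp add: y_def)
    then show "p \<in> (\<lambda>t. \<kappa> (f t)) ` {0..1}" using t x by force
  qed
qed

lemma integer_valued_constant:
  fixes g :: "real \<Rightarrow> real"
  assumes "continuous_on {0..1} g" "\<And>s. s \<in> {0..1} \<Longrightarrow> g s \<in> \<int>"
  shows "g 1 = g 0"
proof -
  have "g constant_on {0..1}"
  proof (rule continuous_discrete_range_constant[OF _ assms(1)])
    fix x :: real assume x: "x \<in> {0..1}"
    show "\<exists>e>0. \<forall>y. y \<in> {0..1} \<and> g y \<noteq> g x \<longrightarrow> e \<le> norm (g y - g x)"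
      using assms(2)[OF x] assms(2) by (intro exI[of _ 1]) (auto intro!: Ints_nonzero_abs_ge1)
  qed simp
  then show ?thesis by (auto simp: constant_on_def)
qed

context thick_loop
begin

text \<open>
The segment from \<open>\<gamma> t\<close> to \<open>\<sigma> t\<close> stays in the tube, so the feet of its points form a homotopy from \<open>\<gamma>\<close> to
\<open>foot \<circ> \<sigma>\<close> in one component of \<open>K\<close>. All loops of the homotopy have the same degree. The lift of the
whole homotopy also relates the tangents at the two ends of each segment.
\<close>

lemma homotopy_lift:
  assumes \<gamma>: "simple_loop \<gamma>" "path_image \<gamma> \<subseteq> path_image \<kappa>" and \<sigma>: "simple_loop \<sigma>"
    and near: "\<And>t. t \<in> {0..1} \<Longrightarrow> dist (\<gamma> t) (\<sigma> t) \<le> \<delta>" and d: "2 * \<delta> < \<rho>" "0 < \<delta>"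
    and comp: "\<And>C. connected C \<Longrightarrow> C \<subseteq> K \<Longrightarrow> C \<inter> path_image \<kappa> \<noteq> {} \<Longrightarrow> C \<subseteq> path_image \<kappa>"
  obtains f where "continuous_on ({0..1} \<times> {0..1}) f"
    "\<And>s t. s \<in> {0..1} \<Longrightarrow> t \<in> {0..1} \<Longrightarrow> foot ((1 - s) *\<^sub>R \<gamma> t + s *\<^sub>R \<sigma> t) = \<kappa> (f (s, t))"
    "f (1, 1) - f (1, 0) = f (0, 1) - f (0, 0)"
proof -
  define X where "X z = (1 - fst z) *\<^sub>R \<gamma> (snd z) + fst z *\<^sub>R \<sigma> (snd z)" for z
  let ?S = "{0..1::real} \<times> {0..1::real}"
  have \<gamma>K: "\<gamma> t \<in> K" if "t \<in> {0..1}" for t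
    using \<gamma>(2) that curve_in simple_loop_range[OF loop] by (force simp: path_image_def)
  have distX: "dist (X z) (\<gamma> (snd z)) \<le> \<delta>" if z: "z \<in> ?S" for z
  proof -
    have "X z - \<gamma> (snd z) = fst z *\<^sub>R (\<sigma> (snd z) - \<gamma> (snd z))" by (simp add: X_def algebra_simps)
    then have "dist (X z) (\<gamma> (snd z)) = fst z * dist (\<gamma> (snd z)) (\<sigma> (snd z))"
      using z by (auto simp: dist_norm norm_minus_commute)
    also have "\<dots> \<le> 1 * \<delta>" using z near[of "snd z"] by (intro mult_mono) auto
    finally show ?thesis by simp
  qed
  have tube: "infdist (X z) K < \<rho>" if z: "z \<in> ?S" for z
    unfolding infdist_less_iff using distX[OF z] d \<gamma>K[of "snd z"] z by (intro bexI[of _ "\<gamma> (snd z)"]) auto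
  have contX: "continuous_on ?S X"
    unfolding X_def
    by (intro continuous_intros continuous_on_compose2[OF simple_loop_continuous_on[OF \<gamma>(1)]]
        continuous_on_compose2[OF simple_loop_continuous_on[OF \<sigma>]]) auto
  have contF: "continuous_on ?S (\<lambda>z. foot (X z))"
    by (rule continuous_on_compose2[OF continuous_on_foot contX]) (use tube in auto)
  have conv: "convex ?S" by (intro convex_Times convex_real_interval)
  have sub: "(\<lambda>z. foot (X z)) ` ?S \<subseteq> path_image \<kappa>"
  proof (rule comp)
    show "connected ((\<lambda>z. foot (X z)) ` ?S)"
      by (rule connected_continuous_image[OF contF convex_connected[OF conv]])
    show "(\<lambda>z. foot (X z)) ` ?S \<subseteq> K" using foot_in by auto
    have "foot (X (0, 0)) = \<gamma> 0" using foot_of_mem[OF \<gamma>K[of 0]] by (simp add: X_def)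
    moreover have "\<gamma> 0 \<in> path_image \<kappa>" using \<gamma>(2) by (auto simp: path_image_def)
    ultimately show "(\<lambda>z. foot (X z)) ` ?S \<inter> path_image \<kappa> \<noteq> {}" by force
  qed
  obtain f where f: "continuous_on ?S f" "\<And>z. z \<in> ?S \<Longrightarrow> foot (X z) = \<kappa> (f z)"
    using simple_loop_lift[OF loop contF sub convex_imp_contractible[OF conv]] by blast
  have "(\<lambda>s. f (s, 1) - f (s, 0)) 1 = (\<lambda>s. f (s, 1) - f (s, 0)) 0"
  proof (rule integer_valued_constant)
    show "continuous_on {0..1} (\<lambda>s. f (s, 1) - f (s, 0))"
      by (intro continuous_intros continuous_on_compose2[OF f(1)]) auto
    fix s :: real assume s: "s \<in> {0..1}"
    have "\<gamma> 1 = \<gamma> 0" "\<sigma> 1 = \<sigma> 0" using simple_loop_eq_iff[OF \<gamma>(1), of 1 0] simple_loop_eq_iff[OF \<sigma>, of 1 0] by auto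
    then have "X (s, 1) = X (s, 0)" by (simp add: X_def)
    then have "\<kappa> (f (s, 1)) = \<kappa> (f (s, 0))" using f(2)[of "(s, 1)"] f(2)[of "(s, 0)"] s by simp
    then show "f (s, 1) - f (s, 0) \<in> \<int>" using simple_loop_eq_iff[OF loop] by blast
  qed
  then have per: "f (1, 1) - f (1, 0) = f (0, 1) - f (0, 0)" by simp
  have "foot ((1 - s) *\<^sub>R \<gamma> t + s *\<^sub>R \<sigma> t) = \<kappa> (f (s, t))" if "s \<in> {0..1}" "t \<in> {0..1}" for s t
    using f(2)[of "(s, t)"] that by (simp add: X_def)
  then show thesis using that[OF f(1) _ per] by blast
qed

text \<open>
The lift \<open>g\<close> of \<open>foot \<circ> \<sigma>\<close> is strictly increasing with total increment \<open>1\<close>. Hence the foot of \<open>\<sigma> t\<close>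
runs through the component exactly once.
\<close>

lemma nearby_loop_oriented:
  assumes \<gamma>: "simple_loop \<gamma>" and \<sigma>: "simple_loop \<sigma>" "rectifiable \<sigma>"
    and near: "\<And>t. t \<in> {0..1} \<Longrightarrow> dist (\<gamma> t) (\<sigma> t) \<le> \<delta>" and d: "2 * \<delta> < \<rho>" "0 < \<delta>"
    and f: "continuous_on ({0..1} \<times> {0..1}) f"
    and lift: "\<And>s t. s \<in> {0..1} \<Longrightarrow> t \<in> {0..1} \<Longrightarrow> foot ((1 - s) *\<^sub>R \<gamma> t + s *\<^sub>R \<sigma> t) = \<kappa> (f (s, t))"
    and \<gamma>K: "path_image \<gamma> \<subseteq> K"
    and mono: "strict_mono_on {0..1} (\<lambda>t. f (0, t))" and per: "f (0, 1) = f (0, 0) + 1" "f (1, 1) - f (1, 0) = f (0, 1) - f (0, 0)"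
    and E: "E \<subseteq> {0..1}" "length_null \<sigma> E"
    and tan: "\<And>t. t \<in> {0..1} - E \<Longrightarrow> \<exists>w v. has_unit_tangent \<gamma> w t \<and> has_unit_tangent \<sigma> v t \<and>
       sin (2 * arcsin (\<delta> / \<rho>)) \<le> w \<bullet> v"
  shows "inj_on (foot \<circ> \<sigma>) {0..<1} \<and> foot ` path_image \<sigma> = path_image \<kappa> \<and> path_image \<gamma> = path_image \<kappa>"
proof -
  define \<phi> g where "\<phi> t = f (0, t)" and "g t = f (1, t)" for t
  have \<gamma>in: "\<gamma> t \<in> K" if "t \<in> {0..1}" for t using \<gamma>K that by (auto simp: path_image_def)
  have phi: "\<gamma> t = \<kappa> (\<phi> t)" if t: "t \<in> {0..1}" for t
    using lift[of 0 t] t foot_of_mem[OF \<gamma>in[OF t]] by (simp add: \<phi>_def)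
  have g: "foot (\<sigma> t) = \<kappa> (g t)" if t: "t \<in> {0..1}" for t
    using lift[of 1 t] t by (simp add: g_def)
  have cont: "continuous_on {0..1} \<phi>" "continuous_on {0..1} g"
    unfolding \<phi>_def g_def by (intro continuous_on_compose2[OF f] continuous_intros; auto)+
  have TT: "0 < T (\<phi> t) \<bullet> T (g t)" if t: "t \<in> {0..1}" for t
    unfolding \<phi>_def g_def
  proof (rule tangent_sign_persists[of "\<lambda>s. f (s, t)", simplified])
    show "continuous_on {0..1} (\<lambda>s. f (s, t))"
      by (intro continuous_on_compose2[OF f] continuous_intros) (use t in auto)
    fix s :: real assume "0 \<le> s \<and> s \<le> 1"
    then have s: "s \<in> {0..1}" by simp
    let ?X = "(1 - s) *\<^sub>R \<gamma> t + s *\<^sub>R \<sigma> t"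
    have "?X - \<gamma> t = s *\<^sub>R (\<sigma> t - \<gamma> t)" by (simp add: algebra_simps)
    then have "dist ?X (\<gamma> t) = s * dist (\<gamma> t) (\<sigma> t)" using s by (auto simp: dist_norm norm_minus_commute)
    also have "\<dots> \<le> 1 * \<delta>" using s near[OF t] by (intro mult_mono) auto
    finally have "(dist (foot ?X) (\<gamma> t))\<^sup>2 < 2 * \<delta>\<^sup>2"
      using foot_drift[OF \<gamma>in[OF t], of ?X \<delta>] d by simp
    moreover have "\<delta>\<^sup>2 \<le> \<rho>\<^sup>2" using d by (intro power_mono) auto
    ultimately show "(norm (\<kappa> (f (s, t)) - \<kappa> (f (0, t))))\<^sup>2 < 2 * \<rho>\<^sup>2"
      using lift[OF s t] phi[OF t] by (simp add: dist_norm \<phi>_def)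
  qed
  have "strict_mono_on {0..1} g"
  proof (rule foot_lift_strict_mono[OF \<sigma> cont(2) _ d(1) E])
    fix t :: real assume t: "t \<in> {0..1}"
    show "foot (\<sigma> t) = \<kappa> (g t) \<and> dist (\<sigma> t) (foot (\<sigma> t)) \<le> \<delta>"
      using g[OF t] foot_le[OF \<gamma>in[OF t], of "\<sigma> t"] near[OF t] by (simp add: dist_commute)
  next
    fix t assume t: "t \<in> {0<..<1} - E"
    then have t01: "t \<in> {0..1}" by auto
    from tan[of t] t obtain w v where w: "has_unit_tangent \<gamma> w t" and v: "has_unit_tangent \<sigma> v t"
       and wv: "sin (2 * arcsin (\<delta> / \<rho>)) \<le> w \<bullet> v" by auto
    have "has_unit_tangent \<gamma> (T (\<phi> t)) t"
      using has_unit_tangent_reparametrized[OF has_unit_tangent_derivative[OF deriv deriv_nz] cont(1) _ _ phi] mono t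
      by (simp add: \<phi>_def[abs_def])
    then have "w = T (\<phi> t)" using w has_unit_tangent_unique by blast
    have "0 < v \<bullet> T (g t)"
    proof (rule transversality[OF d(2,1) g[OF t01] _ TT[OF t01] has_unit_tangent_norm[OF \<sigma>(1) v]])
      show "dist (\<sigma> t) (\<kappa> (\<phi> t)) \<le> \<delta>" using near[OF t01] phi[OF t01] by (simp add: dist_commute)
      show "sin (2 * arcsin (\<delta> / \<rho>)) \<le> T (\<phi> t) \<bullet> v" using wv \<open>w = T (\<phi> t)\<close> by simp
    qed
    then show "\<exists>v. has_unit_tangent \<sigma> v t \<and> 0 < v \<bullet> T (g t)" using v by blast
  qed
  note gmono = this
  have g1: "g 1 = g 0 + 1" and phi1: "\<phi> 1 = \<phi> 0 + 1" using per by (auto simp: g_def \<phi>_def)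
  have "inj_on (foot \<circ> \<sigma>) {0..<1}"
  proof (rule inj_onI)
    fix x y :: real assume xy: "x \<in> {0..<1}" "y \<in> {0..<1}" "(foot \<circ> \<sigma>) x = (foot \<circ> \<sigma>) y"
    then have "\<kappa> (g x) = \<kappa> (g y)" using g[of x] g[of y] by simp
    then have "g x - g y \<in> \<int>" using simple_loop_eq_iff[OF loop] by blast
    moreover have "g 0 \<le> g z \<and> g z < g 0 + 1" if "z \<in> {0..<1}" for z
      using strict_mono_onD[OF gmono, of 0 z] strict_mono_onD[OF gmono, of z 1] that g1 by (cases "z = 0") auto
    then have "g 0 \<le> g x" "g x < g 0 + 1" "g 0 \<le> g y" "g y < g 0 + 1" using xy by auto
    ultimately have "g x = g y" using Ints_nonzero_abs_ge1[of "g x - g y"] by argo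
    then show "x = y" using strict_mono_on_eqD[OF gmono, of x y] xy by auto
  qed
  moreover have "foot ` path_image \<sigma> = (\<lambda>t. \<kappa> (g t)) ` {0..1}"
    unfolding path_image_def image_image by (rule image_cong[OF refl g])
  moreover have "path_image \<gamma> = (\<lambda>t. \<kappa> (\<phi> t)) ` {0..1}"
    unfolding path_image_def by (rule image_cong[OF refl phi])
  ultimately show ?thesis
    using unit_period_image[OF loop cont(2) g1] unit_period_image[OF loop cont(1) phi1] by simp
qed

text \<open>
If \<open>\<gamma>\<close> runs through the component against the direction of \<open>\<kappa>\<close>, the direction of \<open>\<kappa>\<close> is reversed.
\<close>

proposition nearby_loop:
  assumes \<gamma>: "simple_loop \<gamma>" "path_image \<gamma> \<subseteq> path_image \<kappa>" and \<sigma>: "simple_loop \<sigma>" "rectifiable \<sigma>"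
    and near: "\<And>t. t \<in> {0..1} \<Longrightarrow> dist (\<gamma> t) (\<sigma> t) \<le> \<delta>" and d: "2 * \<delta> < \<rho>" "0 < \<delta>"
    and comp: "\<And>C. connected C \<Longrightarrow> C \<subseteq> K \<Longrightarrow> C \<inter> path_image \<kappa> \<noteq> {} \<Longrightarrow> C \<subseteq> path_image \<kappa>"
    and E: "E \<subseteq> {0..1}" "length_null \<sigma> E"
    and tan: "\<And>t. t \<in> {0..1} - E \<Longrightarrow> \<exists>w v. has_unit_tangent \<gamma> w t \<and> has_unit_tangent \<sigma> v t \<and>
       sin (2 * arcsin (\<delta> / \<rho>)) \<le> w \<bullet> v"
  shows "inj_on (foot \<circ> \<sigma>) {0..<1} \<and> foot ` path_image \<sigma> = path_image \<kappa> \<and> path_image \<gamma> = path_image \<kappa>"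
proof -
  obtain f where f: "continuous_on ({0..1} \<times> {0..1}) f"
    "\<And>s t. s \<in> {0..1} \<Longrightarrow> t \<in> {0..1} \<Longrightarrow> foot ((1 - s) *\<^sub>R \<gamma> t + s *\<^sub>R \<sigma> t) = \<kappa> (f (s, t))"
    "f (1, 1) - f (1, 0) = f (0, 1) - f (0, 0)"
    using homotopy_lift[OF \<gamma> \<sigma>(1) near d comp] by blast
  have \<gamma>K: "path_image \<gamma> \<subseteq> K" using \<gamma>(2) curve_in by (auto simp: path_image_def)
  have "\<gamma> t = \<kappa> (f (0, t))" if t: "t \<in> {0..1}" for t
  proof -
    have "\<gamma> t \<in> K" using \<gamma>K t by (auto simp: path_image_def)
    then show ?thesis using f(2)[of 0 t] t foot_of_mem by simp
  qed
  moreover have "continuous_on {0..1} (\<lambda>t. f (0, t))"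
    by (intro continuous_on_compose2[OF f(1)] continuous_intros) auto
  ultimately consider "strict_mono_on {0..1} (\<lambda>t. f (0, t))" "f (0, 1) = f (0, 0) + 1"
    | "strict_antimono_on {0..1} (\<lambda>t. f (0, t))" "f (0, 1) = f (0, 0) - 1"
    using lift_of_simple_loop_monotone[OF \<gamma>(1) loop, of "\<lambda>t. f (0, t)"] by blast
  then show ?thesis
  proof cases
    case 1
    show ?thesis by (rule nearby_loop_oriented[OF \<gamma>(1) \<sigma> near d f(1,2) \<gamma>K 1 f(3) E tan])
  next
    case 2
    interpret rev: thick_loop K \<rho> u "\<lambda>t. \<kappa> (- t)" "\<lambda>t. - \<kappa>' (- t)" by (rule reversed)
    have "\<kappa> x \<in> range (\<lambda>t. \<kappa> (- t))" for x by (rule range_eqI[of _ _ "- x"]) simp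
    then have img: "path_image (\<lambda>t. \<kappa> (- t)) = path_image \<kappa>"
      unfolding simple_loop_range[OF loop, symmetric] simple_loop_range[OF rev.loop, symmetric]
      by blast
    have "inj_on (foot \<circ> \<sigma>) {0..<1} \<and> foot ` path_image \<sigma> = path_image (\<lambda>t. \<kappa> (- t)) \<and> path_image \<gamma> = path_image (\<lambda>t. \<kappa> (- t))"
    proof (rule rev.nearby_loop_oriented[OF \<gamma>(1) \<sigma> near d, where f = "\<lambda>z. - f z"])
      show "continuous_on ({0..1} \<times> {0..1}) (\<lambda>z. - f z)" by (intro continuous_intros f)
      show "strict_mono_on {0..1} (\<lambda>t. - f (0, t))" using 2(1) by (auto simp: monotone_on_def)
    qed (use f 2 E tan \<gamma>K in auto)
    then show ?thesis unfolding img .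
  qed
qed

end

text \<open>
For \<open>\<delta> = 0\<close> the two links coincide. This case stands apart because then the two angles of
\<open>transversality\<close> may add up to a right angle.
\<close>

lemma trivial_isotopy:
  "\<exists>H. ambient_isotopy H \<and> H 1 ` K = K \<and> (\<forall>t\<in>{0..1}. \<forall>x. dist x (H t x) \<le> 0)"
proof (intro exI conjI)
  have "homeomorphism UNIV UNIV (\<lambda>x. x) (\<lambda>x. x)" by (simp add: homeomorphism_def)
  then show "ambient_isotopy (\<lambda>t x. x)"
    unfolding ambient_isotopy_def by (auto simp: case_prod_beta intro!: continuous_intros)
qed auto

text \<open>
The vector \<open>u p\<close> is the unit tangent at some parameter of \<open>p\<close>. It does not depend on the parameter,
because parameters of the same point lie on the same component and differ by an integer. Orthogonality at nearest points is the vanishing of the derivative of the squared distance.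
\<close>

lemma thick_loop_of_link:
  assumes "C11_link K" and pos: "thickness K > 0"
  obtains u n \<kappa> \<kappa>' where "link_param n \<kappa> K" "\<And>i. i < n \<Longrightarrow> thick_loop K (thickness K / 2) u (\<kappa> i) (\<kappa>' i)"
proof -
  obtain n \<kappa> where link: "link_param n \<kappa> K" and C1: "\<forall>i<n. \<exists>\<gamma>' L. (\<forall>t. (\<kappa> i has_vector_derivative \<gamma>' t) (at t)) \<and>
          continuous_on UNIV \<gamma>' \<and> (\<forall>t. \<gamma>' t \<noteq> 0) \<and> L-lipschitz_on UNIV (\<lambda>t. sgn (\<gamma>' t))"
    using assms(1) unfolding C11_link_def by blast
  have "\<forall>i. \<exists>d. i < n \<longrightarrow> (\<forall>t. (\<kappa> i has_vector_derivative d t) (at t)) \<and> continuous_on UNIV d \<and> (\<forall>t. d t \<noteq> 0)"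
    using C1 by blast
  from choice[OF this] obtain \<kappa>' where \<kappa>': "\<And>i t. i < n \<Longrightarrow> (\<kappa> i has_vector_derivative \<kappa>' i t) (at t)"
    "\<And>i. i < n \<Longrightarrow> continuous_on UNIV (\<kappa>' i)" "\<And>i t. i < n \<Longrightarrow> \<kappa>' i t \<noteq> 0" by blast
  have loop: "simple_loop (\<kappa> i)" if "i < n" for i using link that by (simp add: link_param_def)
  have in_K: "\<kappa> i t \<in> K" if "i < n" for i t
    using link that simple_loop_range[OF loop[OF that]] unfolding link_param_def by blast
  have "\<forall>p. \<exists>d. p \<in> K \<longrightarrow> (\<exists>i<n. \<exists>t. p = \<kappa> i t \<and> d = sgn (\<kappa>' i t))"
    using link unfolding link_param_def path_image_def by blast
  from choice[OF this] obtain u where u: "\<And>p. p \<in> K \<Longrightarrow> \<exists>i<n. \<exists>t. p = \<kappa> i t \<and> u p = sgn (\<kappa>' i t)" by blast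
  have range: "range (\<kappa> i) \<subseteq> K" if "i < n" for i using in_K[OF that] by blast
  have set: "thick_set K (thickness K / 2) u"
  proof
    show "compact K" by (rule link_compact[OF link])
    have "0 < n" using link by (auto simp: link_param_def)
    then show "K \<noteq> {}" using in_K[of 0] by blast
    show "0 < thickness K / 2" using pos by simp
    fix p assume p: "p \<in> K"
    then obtain i t where it: "i < n" "p = \<kappa> i t" "u p = sgn (\<kappa>' i t)" using u by blast
    show "norm (u p) = 1" using it \<kappa>'(3) by (simp add: norm_sgn)
    show "(2 * (thickness K / 2))\<^sup>2 * ((norm (q - p))\<^sup>2 - ((q - p) \<bullet> u p)\<^sup>2) \<le> norm (q - p) ^ 4" if "q \<in> K" for q
      using tangent_circle_inequality[OF pos range[OF it(1)] that \<kappa>'(1)[OF it(1)] \<kappa>'(3)[OF it(1)], of t] it by simp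
    fix x assume min: "\<And>q. q \<in> K \<Longrightarrow> dist x p \<le> dist x q"
    have "((\<lambda>s. (x - \<kappa> i s) \<bullet> (x - \<kappa> i s)) has_real_derivative - 2 * ((x - p) \<bullet> \<kappa>' i t)) (at t)"
      using \<kappa>'(1)[OF it(1), of t] unfolding has_real_derivative_iff_has_vector_derivative has_vector_derivative_def
      by (auto intro!: derivative_eq_intros simp: it(2) inner_commute algebra_simps)
    moreover have "\<forall>y. \<bar>t - y\<bar> < 1 \<longrightarrow> (x - \<kappa> i t) \<bullet> (x - \<kappa> i t) \<le> (x - \<kappa> i y) \<bullet> (x - \<kappa> i y)"
      using min[OF in_K[OF it(1)]] it(2) by (simp add: dist_norm norm_le)
    ultimately have "- 2 * ((x - p) \<bullet> \<kappa>' i t) = 0" by (rule DERIV_local_min[OF _ zero_less_one])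
    then show "(x - p) \<bullet> u p = 0" by (simp add: it(3) sgn_div_norm)
  qed
  have "thick_loop K (thickness K / 2) u (\<kappa> i) (\<kappa>' i)" if i: "i < n" for i
  proof -
    interpret thick_set K "thickness K / 2" u by (rule set)
    show ?thesis
    proof
      fix t
      show "\<kappa> i t \<in> K" by (rule in_K[OF i])
      show "(\<kappa> i has_vector_derivative \<kappa>' i t) (at t)" "continuous_on UNIV (\<kappa>' i)" "\<kappa>' i t \<noteq> 0"
        using \<kappa>' i by blast+
      show "simple_loop (\<kappa> i)" by (rule loop[OF i])
      obtain j s where js: "j < n" "\<kappa> i t = \<kappa> j s" "u (\<kappa> i t) = sgn (\<kappa>' j s)" using u[OF in_K[OF i]] by blast
      have "i = j"
      proof (rule ccontr)
        assume "i \<noteq> j"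
        then have "path_image (\<kappa> i) \<inter> path_image (\<kappa> j) = {}"
          using link i js(1) unfolding link_param_def disjoint_family_on_def by blast
        then show False using js(2) simple_loop_range[OF loop[OF i]] simple_loop_range[OF loop[OF js(1)]] by (metis disjoint_iff rangeI)
      qed
      then have "t - s \<in> \<int>" using js(2) simple_loop_eq_iff[OF loop[OF i]] by blast
      then obtain m where m: "s = t + of_int m" by (metis Ints_cases add.commute diff_add_cancel diff_minus_eq_add of_int_minus minus_diff_eq)
      have "((\<lambda>r. r + of_int m) has_real_derivative 1) (at t)" by (auto intro!: derivative_eq_intros)
      then have "((\<lambda>r. \<kappa> i (r + of_int m)) has_vector_derivative \<kappa>' i s) (at t)"
        using vector_diff_chain_at[of "\<lambda>r. r + of_int m" 1 t "\<kappa> i" "\<kappa>' i s"] \<kappa>'(1)[OF i, of s]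
        by (simp add: o_def m has_real_derivative_iff_has_vector_derivative)
      moreover have "(\<lambda>r. \<kappa> i (r + of_int m)) = \<kappa> i" by (rule ext) (rule simple_loop_shift[OF loop[OF i]])
      ultimately have "\<kappa>' i s = \<kappa>' i t" using \<kappa>'(1)[OF i, of t] vector_derivative_unique_at by metis
      then show "sgn (\<kappa>' i t) = u (\<kappa> i t) \<or> sgn (\<kappa>' i t) = - u (\<kappa> i t)" using js(3) \<open>i = j\<close> by simp
    qed
  qed
  then show thesis using that link by blast
qed

section \<open>Links that are close to a thick link\<close>

lemma sin_le_inner_of_vec_angle_le:
  assumes "vec_angle v w \<le> pi / 2 - b" "0 \<le> b" "norm v = 1" "norm w = 1"
  shows "sin b \<le> v \<bullet> w"
proof -
  have i: "\<bar>v \<bullet> w\<bar> \<le> 1" using Cauchy_Schwarz_ineq2[of v w] assms by simp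
  have a: "arccos (v \<bullet> w) \<le> pi / 2 - b" using assms by (simp add: vec_angle_def)
  have "cos (pi / 2 - b) \<le> cos (arccos (v \<bullet> w))"
  proof (rule cos_monotone_0_pi_le[OF _ a])
    show "0 \<le> arccos (v \<bullet> w)" using i by (intro arccos_lbound) auto
    show "pi / 2 - b \<le> pi" using assms(2) pi_gt_zero by linarith
  qed
  then show ?thesis using i by (simp add: cos_diff)
qed

lemma simple_loop_homeomorphic_image:
  assumes \<gamma>: "simple_loop \<gamma>" and h: "continuous_on (path_image \<gamma>) h" "inj_on h (path_image \<gamma>)"
  shows "simple_loop (h \<circ> \<gamma>)"
proof -
  have "simple_path \<gamma>" using \<gamma> by (simp add: simple_loop_def)
  then have "simple_path (h \<circ> \<gamma>)" by (intro simple_path_continuous_image h)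
  then show ?thesis using \<gamma> by (simp add: simple_loop_def)
qed

text \<open>
The loop \<open>h \<circ> \<gamma>\<close> that the homeomorphism transports from \<open>K\<close> is some parametrization of a component of
\<open>K'\<close>, and its arc length is meaningful only once it is known to be finite.
\<close>

lemma rectifiable_loop_in_rectifiable_link:
  assumes "rectifiable_link K" and \<gamma>: "simple_loop \<gamma>" "path_image \<gamma> \<subseteq> K"
  shows "rectifiable \<gamma>"
proof -
  obtain n \<kappa> where link: "link_param n \<kappa> K" and rect: "\<forall>i<n. rectifiable (\<kappa> i)"
    using assms(1) unfolding rectifiable_link_def by blast
  have "path \<gamma>" using \<gamma>(1) by (simp add: simple_loop_def simple_path_def)
  then have "connected (path_image \<gamma>)" by (rule connected_path_image)
  moreover have "path_image \<gamma> \<noteq> {}" by simp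
  ultimately obtain j where j: "j < n" "path_image \<gamma> \<subseteq> path_image (\<kappa> j)"
    using component_within_component[OF link _ \<gamma>(2)] by blast
  have "simple_loop (\<kappa> j)" using link j(1) by (simp add: link_param_def)
  then show ?thesis using rectifiable_within_rectifiable[OF \<gamma>(1) _ j(2)] rect j(1) by blast
qed

lemma simple_loop_path_image_half_open:
  assumes "simple_loop \<gamma>"
  shows "path_image \<gamma> = \<gamma> ` {0..<1}"
proof -
  have "\<gamma> 1 = \<gamma> 0" using simple_loop_eq_iff[OF assms, of 1 0] by simp
  moreover have "{0..1::real} = insert 1 {0..<1}" by auto
  ultimately show ?thesis unfolding path_image_def by force
qed

theorem proposition3p1:
  fixes K K' :: "(real ^ 3) set" and \<tau> \<delta> \<theta> :: real
  assumes "C11_link K" and "thickness K = \<tau>" and "\<tau> > 0"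
    and "\<delta> < \<tau> / 4"
    and "\<theta> = pi / 2 - 2 * arcsin (2 * \<delta> / \<tau>)"
    and "rectifiable_link K'"
    and "links_close \<delta> \<theta> K K'"
  shows "\<exists>H. ambient_isotopy H \<and> H 1 ` K' = K \<and>
             (\<forall>t\<in>{0..1}. \<forall>x. dist x (H t x) \<le> \<delta>)"
proof -
  obtain h h' m \<gamma> where h: "homeomorphism K K' h h'" and near: "\<And>p. p \<in> K \<Longrightarrow> dist p (h p) \<le> \<delta>"
    and link: "link_param m \<gamma> K"
    and E: "\<forall>i<m. \<exists>E. length_null (\<gamma> i) E \<and> length_null (h \<circ> \<gamma> i) E \<and>
            (\<forall>t\<in>{0..1} - E. \<exists>u v. has_unit_tangent (\<gamma> i) u t \<and>
               has_unit_tangent (h \<circ> \<gamma> i) v t \<and> vec_angle u v \<le> \<theta>)"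
    using assms(7) unfolding links_close_def by metis
  have hK: "h ` K = K'" and hinj: "inj_on h K" and hcont: "continuous_on K h"
    using h by (auto simp: homeomorphism_def intro: inj_on_inverseI[of K h' h])
  obtain u n \<kappa> \<kappa>' where \<kappa>link: "link_param n \<kappa> K"
    and \<kappa>: "\<And>i. i < n \<Longrightarrow> thick_loop K (thickness K / 2) u (\<kappa> i) (\<kappa>' i)"
    using thick_loop_of_link[OF assms(1)] assms(2,3) by metis
  define \<rho> where "\<rho> = thickness K / 2"
  note \<kappa> = \<kappa>[folded \<rho>_def]
  have "0 < n" using \<kappa>link by (simp add: link_param_def)
  then interpret thick_loop K \<rho> u "\<kappa> 0" "\<kappa>' 0" by (rule \<kappa>)
  have d0: "0 \<le> \<delta>" using K_ne near zero_le_dist order_trans by blast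
  show ?thesis
  proof (cases "\<delta> = 0")
    case True
    then have "h p = p" if "p \<in> K" for p using near[OF that] by simp
    then have "K' = K" using hK by force
    then show ?thesis using trivial_isotopy True by blast
  next
    case False
    then have d: "0 < \<delta>" "2 * \<delta> < \<rho>" using d0 assms(2,4) by (auto simp: \<rho>_def)
    \<comment> \<open>Each component of \<open>K'\<close> is projected bijectively onto the corresponding component of \<open>K\<close>.\<close>
    have comp: "inj_on (foot \<circ> (h \<circ> \<gamma> i)) {0..<1} \<and> foot ` path_image (h \<circ> \<gamma> i) = path_image (\<gamma> i)"
      if i: "i < m" for i
    proof -
      have loop_i: "simple_loop (\<gamma> i)" and sub: "path_image (\<gamma> i) \<subseteq> K"
        using link i by (auto simp: link_param_def)
      have loop_h: "simple_loop (h \<circ> \<gamma> i)"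
        by (intro simple_loop_homeomorphic_image loop_i continuous_on_subset[OF hcont sub] inj_on_subset[OF hinj sub])
      have rect: "rectifiable (h \<circ> \<gamma> i)"
        by (rule rectifiable_loop_in_rectifiable_link[OF assms(6) loop_h])
           (use sub hK in \<open>auto simp: path_image_compose\<close>)
      have "path (\<gamma> i)" using loop_i by (simp add: simple_loop_def simple_path_def)
      then obtain j where j: "j < n" "path_image (\<gamma> i) \<subseteq> path_image (\<kappa> j)"
        using component_within_component[OF \<kappa>link connected_path_image sub] by auto
      interpret j: thick_loop K \<rho> u "\<kappa> j" "\<kappa>' j" by (rule \<kappa>[OF j(1)])
      obtain E where E: "length_null (h \<circ> \<gamma> i) E" and
         tan: "\<And>t. t \<in> {0..1} - E \<Longrightarrow> \<exists>u v. has_unit_tangent (\<gamma> i) u t \<and>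
               has_unit_tangent (h \<circ> \<gamma> i) v t \<and> vec_angle u v \<le> \<theta>"
        using E i by metis
      have "inj_on (foot \<circ> (h \<circ> \<gamma> i)) {0..<1} \<and> foot ` path_image (h \<circ> \<gamma> i) = path_image (\<kappa> j) \<and>
          path_image (\<gamma> i) = path_image (\<kappa> j)"
      proof (rule j.nearby_loop[OF loop_i j(2) loop_h rect _ d(2,1), of "E \<inter> {0..1}"])
        show "dist (\<gamma> i t) ((h \<circ> \<gamma> i) t) \<le> \<delta>" if "t \<in> {0..1}" for t
        proof -
          have "\<gamma> i t \<in> K" using sub that unfolding path_image_def by blast
          then show ?thesis using near by simp
        qed
        show "C \<subseteq> path_image (\<kappa> j)" if "connected C" "C \<subseteq> K" "C \<inter> path_image (\<kappa> j) \<noteq> {}" for C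
          by (rule connected_in_one_component[OF \<kappa>link that(1,2) j(1) that(3)])
        show "length_null (h \<circ> \<gamma> i) (E \<inter> {0..1})"
          using E unfolding length_null_def by (rule negligible_subset) blast
        fix t assume t: "t \<in> {0..1} - E \<inter> {0..1}"
        then obtain v w where vw: "has_unit_tangent (\<gamma> i) v t" "has_unit_tangent (h \<circ> \<gamma> i) w t" "vec_angle v w \<le> \<theta>"
          using tan[of t] by blast
        have eq: "2 * \<delta> / \<tau> = \<delta> / \<rho>" using assms(2) by (simp add: \<rho>_def)
        have "0 \<le> \<delta> / \<rho>" "\<delta> / \<rho> \<le> 1" using d by (auto simp: field_simps)
        then have "0 \<le> arcsin (\<delta> / \<rho>)" using arcsin_le_arcsin[of 0 "\<delta> / \<rho>"] by simp
        then have "sin (2 * arcsin (\<delta> / \<rho>)) \<le> v \<bullet> w"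
          using vw(3) has_unit_tangent_norm[OF loop_i vw(1)] has_unit_tangent_norm[OF loop_h vw(2)] eq
          by (intro sin_le_inner_of_vec_angle_le) (auto simp: assms(5))
        then show "\<exists>v w. has_unit_tangent (\<gamma> i) v t \<and> has_unit_tangent (h \<circ> \<gamma> i) w t \<and>
            sin (2 * arcsin (\<delta> / \<rho>)) \<le> v \<bullet> w" using vw by blast
      qed auto
      then show ?thesis by blast
    qed
    have K: "K = (\<Union>i<m. path_image (\<gamma> i))" using link by (simp add: link_param_def)
    have K': "K' = (\<Union>i<m. path_image (h \<circ> \<gamma> i))"
      unfolding hK[symmetric] K path_image_compose by blast
    have im: "foot ` K' = K" unfolding K' image_UN using comp K by simp
    have inj: "inj_on foot K'"
    proof (rule inj_onI)
      fix x y assume xy: "x \<in> K'" "y \<in> K'" "foot x = foot y"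
      have half: "path_image (h \<circ> \<gamma> i) = (h \<circ> \<gamma> i) ` {0..<1}" if "i < m" for i
        using link that simple_loop_path_image_half_open[of "\<gamma> i"]
        by (simp add: link_param_def path_image_compose image_comp)
      obtain i where i: "i < m" "x \<in> path_image (h \<circ> \<gamma> i)" using xy(1) K' by blast
      obtain k where k: "k < m" "y \<in> path_image (h \<circ> \<gamma> k)" using xy(2) K' by blast
      have "foot x \<in> path_image (\<gamma> i) \<inter> path_image (\<gamma> k)"
        using comp[OF i(1)] comp[OF k(1)] i(2) k(2) xy(3) by blast
      then have "i = k" using link i(1) k(1) unfolding link_param_def disjoint_family_on_def by blast
      then obtain s t where "s \<in> {0..<1}" "x = (h \<circ> \<gamma> i) s" "t \<in> {0..<1}" "y = (h \<circ> \<gamma> i) t"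
        using i k half by blast
      then show "x = y" using comp[OF i(1)] xy(3) by (auto dest: inj_onD[of _ _ s t])
    qed
    have close: "dist x (foot x) \<le> \<delta>" if x: "x \<in> K'" for x
    proof -
      obtain p where "p \<in> K" "x = h p" using x hK by blast
      then show ?thesis using near[of p] foot_le[of p x] by (simp add: dist_commute)
    qed
    have "compact K'" using assms(6) link_compact unfolding rectifiable_link_def by blast
    from isotopy_onto_core[OF this inj im d close] obtain H :: "real \<Rightarrow> real^3 \<Rightarrow> real^3" where
      "continuous_on ({0..1} \<times> UNIV) (\<lambda>(t, x). H t x)"
      "\<And>t. t \<in> {0..1} \<Longrightarrow> \<exists>G. homeomorphism UNIV UNIV (H t) G"
      "\<And>x. H 0 x = x" "H 1 ` K' = K" "\<And>t x. t \<in> {0..1} \<Longrightarrow> dist x (H t x) \<le> \<delta>" by blast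
    then show ?thesis unfolding ambient_isotopy_def by blast
  qed
qed

end
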